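(* Let $E$ be a nonautonomous similar set in $\mathbb R^d$ with contraction ratios $c_{k,i}$ ($1\le i\le n_k$, $k\ge1$) satisfying $\inf_{k,i}c_{k,i}>0$ and $\sup_{k,i}c_{k,i}<1$, and suppose that $E$ satisfies the strong separation condition. Let $\mu$ be a positive finite Borel measure on $\Sigma^\infty$, and let $\mu^\omega$ be its image measure under the projection $\Pi^\omega$. Then for all $q>0$, $$\underline{D}_q(\mu^\omega)=\min\{d_q^-,d\}\quad\text{and}\quad\overline{D}_q(\mu^\omega)=\min\{d_q^+,d\},$$ where $d_q^-$ and $d_q^+$ are the critical values (see context) with respect to $(c_{k,1},\dots,c_{k,n_k})_{k\ge1}$.
   Context: **Words.** Let $\{n_k\}_{k\ge1}$ be integers $\ge2$; $\Sigma^k=\{u_1\cdots u_k:1\le u_j\le n_j\}$, $\Sigma^0=\{\emptyset\}$, $\Sigma^*=\bigcup_{k\ge0}\Sigma^k$, $\Sigma^\infty=\{u_1u_2\cdots:1\le u_k\le n_k\}$. For $\mathbf u=u_1\cdots u_k$ write $|\mathbf u|=k$ and $\mathbf u^-=u_1\cdots u_{k-1}$. $\mathcal C_{\mathbf u}\subset\Sigma^\infty$ is the cylinder of infinite words with prefix $\mathbf u$. **Nonautonomous similar set.** Let $J\subset\mathbb R^d$ be compact with non-empty interior and let $\Xi_k=\{T_{k,1},\dots,T_{k,n_k}\}$ be collections of $d\times d$ matrices which are contracting similarities: $|T_{k,i}(x)-T_{k,i}(y)|=c_{k,i}|x-y|$ with $0<c_{k,i}<1$. A collection $\{J_{\mathbf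 u}:\mathbf u\in\Sigma^*\}$ of closed subsets of $J$ fulfils the nonautonomous structure if: (1) $J_\emptyset=J$ and $J_{\mathbf u1},\dots,J_{\mathbf un_k}\subset J_{\mathbf u}$ for all $\mathbf u\in\Sigma^{k-1}$; (2) for each $\mathbf u=u_1\cdots u_k$, $J_{\mathbf u}=\Psi_{u_1}\circ\cdots\circ\Psi_{u_k}(J)$, where $\Psi_{u_j}(x)=T_{j,u_j}x+\omega_{u_1\cdots u_j}$ for some $\omega_{u_1\cdots u_j}\in\mathbb R^d$; (3) $\lim_{k\to\infty}\max_{\mathbf u\in\Sigma^k}|J_{\mathbf u}|=0$, where $|\cdot|$ is diameter. The nonautonomous similar set is $E=\bigcap_{k\ge1}\bigcup_{\mathbf u\in\Sigma^k}J_{\mathbf u}$. The projection $\Pi^\omega:\Sigma^\infty\to E$ sends $\mathbf u=u_1u_2\cdots$ to the unique point of $\bigcap_{k}J_{u_1\cdots u_k}$, and $\mu^\omega(A)=\mu\{\mathbf u:\Pi^\omega(\mathbf u)\in A\}$. **Strong separation condition (SSC).** For all $k\in\mathbb N$, $\mathbf u\in\Sigma^{k-1}$ and $i\ne i'\in\{1,\dots,n_k\}$: $J_{\mathbf ui}\cap J_{\mathbf ui'}=\emptyset$. **Generalized $q$-dimensions.** Let $\mathcal M_r$ be the family of $r$-mesh cubes $[j_1r,(j_1+1)r)\times\cdots\times[j_dr,(j_d+1)r)$, $j_i\in\mathbb Z$. For a finite Borel measure $\nu$ on $\mathbb R^d$ and $q\ne1$, $\underline D_q(\nu)$ and $\overline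 D_q(\nu)$ are the $\liminf$ and $\limsup$ as $r\to0$ of $\frac{\log\sum_{Q\in\mathcal M_r}\nu(Q)^q}{(q-1)\log r}$; $\underline D_1(\nu)$ and $\overline D_1(\nu)$ are the $\liminf$ and $\limsup$ as $r\to0$ of $\frac{\sum_{Q\in\mathcal M_r}\nu(Q)\log\nu(Q)}{\log r}$. **Critical values.** Put $c_{\mathbf u}=c_{1,u_1}\cdots c_{k,u_k}$ ($c_\emptyset=1$), and for $s>0$, $0<r<1$, $\Sigma^*(s,r)=\{\mathbf u\in\Sigma^*:c_{\mathbf u}\le r<c_{\mathbf u^-}\}$. Let $F_q(s,r)=\sum_{\mathbf u\in\Sigma^*(s,r)}c_{\mathbf u}^{s(1-q)}\mu(\mathcal C_{\mathbf u})^q$ for $q\ne1$ and $F_1(s,r)=\sum_{\mathbf u\in\Sigma^*(s,r)}\mu(\mathcal C_{\mathbf u})\log\big(c_{\mathbf u}^{-s}\mu(\mathcal C_{\mathbf u})\big)$. Then - for $q\ge1$: $d_q^-=\sup\{s:\limsup_{r\to0}F_q(s,r)<\infty\}$, $d_q^+=\sup\{s:\liminf_{r\to0}F_q(s,r)<\infty\}$; - for $0<q<1$: $d_q^-=\inf\{s:\liminf_{r\to0}F_q(s,r)<\infty\}$, $d_q^+=\inf\{s:\limsup_{r\to0}F_q(s,r)<\infty\}$. Here $s$ ranges over $s>0$, with $\sup\emptyset=0$, $\inf\emptyset=+\infty$, $0\log0=0$.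
   Formalization: For q = 1 the measure μ is additionally assumed to have total mass 1; without this the claim is false, since D_1 scales with the total mass while d_1^± do not (e.g. twice the uniform measure on the middle-third Cantor set). *)

theory Defs
  imports "HOL-Analysis.Analysis"
begin

text \<open>
  Levels are counted from 0: \<open>n k\<close>, \<open>T k i\<close>, \<open>c k i\<close> stand for $n_{k+1}$, $T_{k+1,i}$,
  $c_{k+1,i}$, and the entry \<open>u ! k\<close> of a finite word (or \<open>w k\<close> of an infinite one) for its
  $(k+1)$-st letter. Letters are \<open>1, \<dots>, n k\<close>.
\<close>

section \<open>Words\<close>

definition words :: "(nat \<Rightarrow> nat) \<Rightarrow> nat \<Rightarrow> nat list set" where
  "words n k = {u. length u = k \<and> (\<forall>j<k. u ! j \<in> {1..n j})}"

definition fin_words :: "(nat \<Rightarrow> nat) \<Rightarrow> nat list set" where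
  "fin_words n = (\<Union>k. words n k)"

definition inf_words :: "(nat \<Rightarrow> nat) \<Rightarrow> (nat \<Rightarrow> nat) set" where
  "inf_words n = {w. \<forall>k. w k \<in> {1..n k}}"

definition prefix_word :: "(nat \<Rightarrow> nat) \<Rightarrow> nat \<Rightarrow> nat list" where
  "prefix_word w k = map w [0..<k]"

definition cylinder :: "(nat \<Rightarrow> nat) \<Rightarrow> nat list \<Rightarrow> (nat \<Rightarrow> nat) set" where
  "cylinder n u = {w \<in> inf_words n. prefix_word w (length u) = u}"

section \<open>Nonautonomous similar sets\<close>

text \<open>The map $\Psi_{u_{j+1}}$; its translation part depends on the whole prefix
  $u_1 \cdots u_{j+1}$.\<close>

definition Psi :: "(nat \<Rightarrow> nat \<Rightarrow> real^'d^'d) \<Rightarrow> (nat list \<Rightarrow> real^'d) \<Rightarrow> nat list \<Rightarrow> nat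
    \<Rightarrow> real^'d \<Rightarrow> real^'d" where
  "Psi T \<omega> u j = (\<lambda>x. T j (u ! j) *v x + \<omega> (take (Suc j) u))"

definition Psi_comp :: "(nat \<Rightarrow> nat \<Rightarrow> real^'d^'d) \<Rightarrow> (nat list \<Rightarrow> real^'d) \<Rightarrow> nat list
    \<Rightarrow> real^'d \<Rightarrow> real^'d" where
  "Psi_comp T \<omega> u = foldr (\<circ>) (map (Psi T \<omega> u) [0..<length u]) id"

definition contracting_similarities ::
  "(nat \<Rightarrow> nat) \<Rightarrow> (nat \<Rightarrow> nat \<Rightarrow> real^'d^'d) \<Rightarrow> (nat \<Rightarrow> nat \<Rightarrow> real) \<Rightarrow> bool" where
  "contracting_similarities n T c \<longleftrightarrow>
     (\<forall>k. \<forall>i\<in>{1..n k}. 0 < c k i \<and> c k i < 1 \<and>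
        (\<forall>x y. norm (T k i *v x - T k i *v y) = c k i * norm (x - y)))"

definition nonautonomous_structure ::
  "(nat \<Rightarrow> nat) \<Rightarrow> (nat \<Rightarrow> nat \<Rightarrow> real^'d^'d) \<Rightarrow> (nat list \<Rightarrow> real^'d) \<Rightarrow> (real^'d) set
    \<Rightarrow> (nat list \<Rightarrow> (real^'d) set) \<Rightarrow> bool" where
  "nonautonomous_structure n T \<omega> J JJ \<longleftrightarrow>
     (\<forall>u\<in>fin_words n. closed (JJ u) \<and> JJ u \<subseteq> J) \<and>
     JJ [] = J \<and>
     (\<forall>k. \<forall>u\<in>words n k. \<forall>i\<in>{1..n k}. JJ (u @ [i]) \<subseteq> JJ u) \<and>
     (\<forall>u\<in>fin_words n. JJ u = Psi_comp T \<omega> u ` J) \<and>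
     (\<lambda>k. Max ((\<lambda>u. diameter (JJ u)) ` words n k)) \<longlonglongrightarrow> 0"

definition nonautonomous_similar_set ::
  "(nat \<Rightarrow> nat) \<Rightarrow> (nat \<Rightarrow> nat \<Rightarrow> real^'d^'d) \<Rightarrow> (nat \<Rightarrow> nat \<Rightarrow> real) \<Rightarrow> (nat list \<Rightarrow> real^'d)
    \<Rightarrow> (real^'d) set \<Rightarrow> (nat list \<Rightarrow> (real^'d) set) \<Rightarrow> (real^'d) set \<Rightarrow> bool" where
  "nonautonomous_similar_set n T c \<omega> J JJ E \<longleftrightarrow>
     (\<forall>k. 2 \<le> n k) \<and> compact J \<and> interior J \<noteq> {} \<and>
     contracting_similarities n T c \<and> nonautonomous_structure n T \<omega> J JJ \<and>
     E = (\<Inter>k\<in>{1..}. \<Union>u\<in>words n k. JJ u)"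

definition strong_separation :: "(nat \<Rightarrow> nat) \<Rightarrow> (nat list \<Rightarrow> (real^'d) set) \<Rightarrow> bool" where
  "strong_separation n JJ \<longleftrightarrow>
     (\<forall>k. \<forall>u\<in>words n k. \<forall>i\<in>{1..n k}. \<forall>i'\<in>{1..n k}. i \<noteq> i' \<longrightarrow>
        JJ (u @ [i]) \<inter> JJ (u @ [i']) = {})"

definition word_projection :: "(nat list \<Rightarrow> (real^'d) set) \<Rightarrow> (nat \<Rightarrow> nat) \<Rightarrow> real^'d" where
  "word_projection JJ w = (THE x. x \<in> (\<Inter>k. JJ (prefix_word w k)))"

text \<open>Borel sets of $\Sigma^\infty$ refer to the product topology, i.e. the subspace topology
  inherited from \<open>nat \<Rightarrow> nat\<close>. Positive means nonzero.\<close>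

definition positive_finite_borel_measure_on_words ::
  "(nat \<Rightarrow> nat) \<Rightarrow> (nat \<Rightarrow> nat) measure \<Rightarrow> bool" where
  "positive_finite_borel_measure_on_words n \<mu> \<longleftrightarrow>
     sets \<mu> = sets (restrict_space borel (inf_words n)) \<and>
     finite_measure \<mu> \<and> emeasure \<mu> (space \<mu>) > 0"

definition image_measure :: "(nat list \<Rightarrow> (real^'d) set) \<Rightarrow> (nat \<Rightarrow> nat) measure
    \<Rightarrow> (real^'d) measure" where
  "image_measure JJ \<mu> = distr \<mu> borel (word_projection JJ)"

section \<open>Generalized q-dimensions\<close>

definition mesh_cubes :: "real \<Rightarrow> (real^'d) set set" where
  "mesh_cubes r = range (\<lambda>j::int^'d.
     {x. \<forall>i. of_int (j $ i) * r \<le> x $ i \<and> x $ i < (of_int (j $ i) + 1) * r})"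

definition ereal_log :: "ereal \<Rightarrow> ereal" where
  "ereal_log x = (if x \<le> 0 then -\<infinity> else if x = \<infinity> then \<infinity> else ereal (ln (real_of_ereal x)))"

text \<open>The sums over all mesh cubes are taken in the extended reals, since for a measure with
  unbounded support they may diverge to \<open>\<infinity>\<close> (\<open>q < 1\<close>) or \<open>-\<infinity>\<close> (\<open>q = 1\<close>).\<close>

definition dim_quotient :: "real \<Rightarrow> (real^'d) measure \<Rightarrow> real \<Rightarrow> ereal" where
  "dim_quotient q \<nu> r =
     (if q = 1
      then (\<Sum>\<^sub>\<infinity>Q\<in>mesh_cubes r. ereal (measure \<nu> Q * ln (measure \<nu> Q))) / ereal (ln r)
      else ereal_log (\<Sum>\<^sub>\<infinity>Q\<in>mesh_cubes r. ereal (measure \<nu> Q powr q)) / ereal ((q - 1) * ln r))"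

definition lower_dim :: "real \<Rightarrow> (real^'d) measure \<Rightarrow> ereal" where
  "lower_dim q \<nu> = Liminf (at_right 0) (dim_quotient q \<nu>)"

definition upper_dim :: "real \<Rightarrow> (real^'d) measure \<Rightarrow> ereal" where
  "upper_dim q \<nu> = Limsup (at_right 0) (dim_quotient q \<nu>)"

section \<open>Critical values\<close>

definition ratio :: "(nat \<Rightarrow> nat \<Rightarrow> real) \<Rightarrow> nat list \<Rightarrow> real" where
  "ratio c u = (\<Prod>j<length u. c j (u ! j))"

text \<open>$\Sigma^*(s,r)$, which does not depend on \<open>s\<close>. The empty word never belongs to it.\<close>

definition cut_set :: "(nat \<Rightarrow> nat) \<Rightarrow> (nat \<Rightarrow> nat \<Rightarrow> real) \<Rightarrow> real \<Rightarrow> nat list set" where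
  "cut_set n c r = {u \<in> fin_words n. ratio c u \<le> r \<and> r < ratio c (butlast u)}"

text \<open>The cut set is finite for \<open>0 < r\<close> as soon as the ratios are bounded away from 1.\<close>

definition F_sum :: "(nat \<Rightarrow> nat) \<Rightarrow> (nat \<Rightarrow> nat \<Rightarrow> real) \<Rightarrow> (nat \<Rightarrow> nat) measure
    \<Rightarrow> real \<Rightarrow> real \<Rightarrow> real \<Rightarrow> real" where
  "F_sum n c \<mu> q s r =
     (if q = 1
      then \<Sum>u\<in>cut_set n c r. measure \<mu> (cylinder n u) *
             ln (ratio c u powr (- s) * measure \<mu> (cylinder n u))
      else \<Sum>u\<in>cut_set n c r. ratio c u powr (s * (1 - q)) * measure \<mu> (cylinder n u) powr q)"

definition limsup_finite_exponents where
  "limsup_finite_exponents n c \<mu> q =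
     {s::real. 0 < s \<and> Limsup (at_right 0) (\<lambda>r. ereal (F_sum n c \<mu> q s r)) < \<infinity>}"

definition liminf_finite_exponents where
  "liminf_finite_exponents n c \<mu> q =
     {s::real. 0 < s \<and> Liminf (at_right 0) (\<lambda>r. ereal (F_sum n c \<mu> q s r)) < \<infinity>}"

text \<open>Inserting \<open>0\<close> realises the convention $\sup\emptyset = 0$ (all exponents are positive);
  $\inf\emptyset = \infty$ holds in \<open>ereal\<close>.\<close>

definition d_minus :: "(nat \<Rightarrow> nat) \<Rightarrow> (nat \<Rightarrow> nat \<Rightarrow> real) \<Rightarrow> (nat \<Rightarrow> nat) measure \<Rightarrow> real
    \<Rightarrow> ereal" where
  "d_minus n c \<mu> q =
     (if 1 \<le> q then Sup (insert 0 (ereal ` limsup_finite_exponents n c \<mu> q))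
      else Inf (ereal ` liminf_finite_exponents n c \<mu> q))"

definition d_plus :: "(nat \<Rightarrow> nat) \<Rightarrow> (nat \<Rightarrow> nat \<Rightarrow> real) \<Rightarrow> (nat \<Rightarrow> nat) measure \<Rightarrow> real
    \<Rightarrow> ereal" where
  "d_plus n c \<mu> q =
     (if 1 \<le> q then Sup (insert 0 (ereal ` liminf_finite_exponents n c \<mu> q))
      else Inf (ereal ` limsup_finite_exponents n c \<mu> q))"

end

theory Submission imports Defs begin

text \<open>
  At scale \<open>r\<close> every piece \<open>JJ u\<close> with \<open>u\<close> in the cut set has diameter at most a constant times
  \<open>r\<close> and contains a ball of radius comparable to \<open>r\<close>, and these pieces are disjoint. Hence a piece
  meets boundedly many mesh cubes and a mesh cube meets boundedly many pieces, so passing from the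
  masses of the cubes to the masses of the cylinders changes the power sum by a bounded factor
  (the entropy by a bounded amount). The quotient defining the \<open>q\<close>-dimension is therefore
  \<open>N r / ln r + o(1)\<close>, where \<open>N\<close> is computed from cylinders only. As \<open>ratio c u\<close> is comparable
  to \<open>r\<close> on the cut set, boundedness of \<open>F_sum\<close> amounts to a one-sided bound on
  \<open>N r - s * ln r\<close>, and the critical exponents are the lower and upper limits of \<open>N r / ln r\<close>.
  They never exceed the dimension of the space because the cut set has at most \<open>O(1 / r ^ d)\<close>
  elements and the power mean inequality bounds \<open>N r\<close> by the logarithm of that number.
\<close>

text \<open>Strong separation gives no uniform gap between the pieces, so a mesh cube may meet
  several of them at every scale. The masses \<open>measure \<mu> (piece u Q)\<close> therefore form
  a matrix whose row sums are the cylinder masses and whose column sums are the cube masses, with at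
  most K nonzero entries in each row and column. Both marginals are compared with the sum over all
  entries, which costs at most ln K after normalisation by q - 1, for every q. The case q = 1 is not
  scale invariant: for total mass M the sum \<open>F_sum\<close> is N r - M * s * ln r up to a
  bounded error, so the dimension would be M times the critical exponent. This is the reason for the
  normalisation of \<mu> when q = 1. For q \<noteq> 1 the total mass only adds a constant to N r,
  which disappears after division by ln r. The bounds on the contraction ratios have separate uses:
  inf > 0 keeps \<open>ratio c u\<close> within a constant factor of r on the cut set, sup < 1 makes
  every infinite word reach the cut set.\<close>

section \<open>Power sums\<close>

text \<open>The tangent to \<open>x powr q\<close> at \<open>b\<close> lies below its graph for \<open>q > 1\<close> and above it for
  \<open>q < 1\<close>; with \<open>b\<close> the mean value this gives the sharp power mean inequalities.\<close>

lemma powr_tangent_le: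
  fixes x b q :: real
  assumes "1 < q" "0 \<le> x" "0 < b"
  shows "q * b powr (q - 1) * x \<le> x powr q + (q - 1) * b powr q"
proof (cases "x = 0")
  case False
  have "(x powr q) powr (1/q) * (b powr q) powr (1 - 1/q) \<le> (1/q) * x powr q + (1 - 1/q) * b powr q"
    using assms False by (intro Youngs_inequality_0) auto
  moreover have "(x powr q) powr (1/q) = x" "(b powr q) powr (1 - 1/q) = b powr (q - 1)"
    using assms by (auto simp: powr_powr algebra_simps)
  ultimately have "q * (x * b powr (q - 1)) \<le> q * ((1/q) * x powr q + (1 - 1/q) * b powr q)"
    using assms by (intro mult_left_mono) auto
  also have "\<dots> = x powr q + (q - 1) * b powr q"
    using assms by (simp add: field_simps)
  finally show ?thesis by (simp add: mult_ac)
qed (use assms in auto)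

lemma powr_tangent_ge:
  fixes x b q :: real
  assumes "0 < q" "q < 1" "0 \<le> x" "0 < b"
  shows "x powr q \<le> q * b powr (q - 1) * x + (1 - q) * b powr q"
proof (cases "x = 0")
  case False
  \<comment> \<open>For q < 1 Young's inequality has weight q on x and 1 - q on b; the factor
    b^(q-1) then turns it into the tangent inequality.\<close>
  have "x powr q * b powr (1 - q) \<le> q * x + (1 - q) * b"
    using assms False by (intro Youngs_inequality_0) auto
  then have "(x powr q * b powr (1 - q)) * b powr (q - 1) \<le> (q * x + (1 - q) * b) * b powr (q - 1)"
    using assms by (intro mult_right_mono) auto
  moreover have b: "b powr (1 - q) * b powr (q - 1) = 1" "b * b powr (q - 1) = b powr q"
    using assms by (auto simp flip: powr_add simp: powr_mult_base)
  have "x powr q * b powr (1 - q) * b powr (q - 1) = x powr q"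
    using b(1) by (simp add: mult.assoc)
  moreover have "(q * x + (1 - q) * b) * b powr (q - 1) = q * b powr (q - 1) * x + (1 - q) * b powr q"
    unfolding b(2)[symmetric] by (simp add: algebra_simps)
  ultimately show ?thesis by linarith
qed (use assms in auto)

text \<open>With b = A / K the summed tangent inequality has q X on one side and (q - 1) X on the
  other, where X = K^(1-q) A^q, so exactly X survives.\<close>

lemma mean_powr:
  fixes A K q :: real
  assumes "0 < A" "0 < K"
  shows "(A / K) powr (q - 1) * A = K powr (1 - q) * A powr q"
    and "K * (A / K) powr q = K powr (1 - q) * A powr q"
  using assms by (simp_all add: powr_divide powr_diff powr_minus field_simps)

lemma sum_le_sum_powr:
  fixes a :: "'a \<Rightarrow> real"
  assumes fin: "finite U" and nn: "\<And>u. u \<in> U \<Longrightarrow> 0 \<le> a u"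
    and q: "1 < q" and K: "real (card U) \<le> K" "0 < sum a U"
  shows "K powr (1 - q) * (sum a U) powr q \<le> (\<Sum>u\<in>U. a u powr q)"
proof -
  define A where "A = sum a U"
  have "U \<noteq> {}" using K by auto
  then have K0: "0 < K" using K fin by (metis card_gt_0_iff of_nat_0_less_iff order_less_le_trans)
  \<comment> \<open>The mean of K terms of total A. K may exceed the number of terms: the surplus
    only enlarges the constant term, whose coefficient q - 1 is positive.\<close>
  define b where "b = A / K"
  have b: "0 < b" using K K0 by (simp add: b_def A_def)
  have "q * b powr (q - 1) * A = (\<Sum>u\<in>U. q * b powr (q - 1) * a u)"
    by (simp add: A_def sum_distrib_left)
  also have "\<dots> \<le> (\<Sum>u\<in>U. a u powr q + (q - 1) * b powr q)"
    by (intro sum_mono powr_tangent_le q nn b)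
  also have "\<dots> = (\<Sum>u\<in>U. a u powr q) + real (card U) * ((q - 1) * b powr q)"
    by (simp add: sum.distrib)
  also have "\<dots> \<le> (\<Sum>u\<in>U. a u powr q) + K * ((q - 1) * b powr q)"
    using K q by (intro add_left_mono mult_right_mono) auto
  finally have "q * (b powr (q - 1) * A) \<le> (\<Sum>u\<in>U. a u powr q) + (q - 1) * (K * b powr q)"
    by (simp add: mult_ac)
  then show ?thesis
    using mean_powr[of A K q] K K0 unfolding b_def by (simp add: A_def left_diff_distrib)
qed

lemma sum_powr_le_sum:
  fixes a :: "'a \<Rightarrow> real"
  assumes fin: "finite U" and nn: "\<And>u. u \<in> U \<Longrightarrow> 0 \<le> a u"
    and q: "0 < q" "q < 1" and K: "real (card U) \<le> K" "0 < sum a U"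
  shows "(\<Sum>u\<in>U. a u powr q) \<le> K powr (1 - q) * (sum a U) powr q"
proof -
  define A where "A = sum a U"
  have "U \<noteq> {}" using K by auto
  then have K0: "0 < K" using K fin by (metis card_gt_0_iff of_nat_0_less_iff order_less_le_trans)
  define b where "b = A / K"
  have b: "0 < b" using K K0 by (simp add: b_def A_def)
  have "(\<Sum>u\<in>U. a u powr q) \<le> (\<Sum>u\<in>U. q * b powr (q - 1) * a u + (1 - q) * b powr q)"
    by (intro sum_mono powr_tangent_ge q nn b)
  also have "\<dots> = q * b powr (q - 1) * A + real (card U) * ((1 - q) * b powr q)"
    by (simp add: A_def sum_distrib_left sum.distrib)
  also have "\<dots> \<le> q * b powr (q - 1) * A + K * ((1 - q) * b powr q)"
    using K q by (intro add_left_mono mult_right_mono) auto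
  finally have "(\<Sum>u\<in>U. a u powr q) \<le> q * (b powr (q - 1) * A) + (1 - q) * (K * b powr q)"
    by (simp add: mult_ac)
  then show ?thesis
    using mean_powr[of A K q] K K0 unfolding b_def by (simp add: A_def left_diff_distrib)
qed

text \<open>Each term is \<open>a u * a u powr (q - 1)\<close>, and the second factor increases with
  its base, which is at most the total.\<close>

lemma sum_powr_le_powr_sum:
  fixes a :: "'a \<Rightarrow> real"
  assumes fin: "finite U" and nn: "\<And>u. u \<in> U \<Longrightarrow> 0 \<le> a u" and q: "1 < q"
  shows "(\<Sum>u\<in>U. a u powr q) \<le> (sum a U) powr q"
proof -
  have "(\<Sum>u\<in>U. a u powr q) \<le> (\<Sum>u\<in>U. a u * (sum a U) powr (q - 1))"
  proof (intro sum_mono)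
    fix u assume u: "u \<in> U"
    have "a u \<le> sum a U" using u fin nn by (intro member_le_sum) auto
    then have "a u * a u powr (q - 1) \<le> a u * sum a U powr (q - 1)"
      using nn[OF u] q by (intro mult_left_mono powr_mono2) auto
    then show "a u powr q \<le> a u * (sum a U) powr (q - 1)"
      using nn[OF u] by (simp add: powr_mult_base)
  qed
  then show ?thesis
    using nn by (simp add: powr_mult_base sum_nonneg flip: sum_distrib_right)
qed

lemma powr_sum_le_sum_powr:
  fixes a :: "'a \<Rightarrow> real"
  assumes fin: "finite U" and nn: "\<And>u. u \<in> U \<Longrightarrow> 0 \<le> a u" and q: "0 < q" "q < 1"
  shows "(sum a U) powr q \<le> (\<Sum>u\<in>U. a u powr q)"
proof -
  have "(\<Sum>u\<in>U. a u * (sum a U) powr (q - 1)) \<le> (\<Sum>u\<in>U. a u powr q)"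
  proof (intro sum_mono)
    fix u assume u: "u \<in> U"
    have "a u \<le> sum a U" using u fin nn by (intro member_le_sum) auto
    \<comment> \<open>For q < 1 the power q - 1 decreases in its base, but only for positive bases;
      a zero term vanishes on both sides.\<close>
    then have "a u * sum a U powr (q - 1) \<le> a u * a u powr (q - 1)" if "a u \<noteq> 0"
      using nn[OF u] q that by (intro mult_left_mono powr_mono2') auto
    then show "a u * (sum a U) powr (q - 1) \<le> a u powr q"
      using nn[OF u] by (cases "a u = 0") (auto simp add: powr_mult_base)
  qed
  then show ?thesis
    using nn by (simp add: powr_mult_base sum_nonneg flip: sum_distrib_right)
qed

lemma sum_entropy_le:
  fixes a :: "'a \<Rightarrow> real"
  assumes fin: "finite U" and nn: "\<And>u. u \<in> U \<Longrightarrow> 0 \<le> a u"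
  shows "(\<Sum>u\<in>U. a u * ln (a u)) \<le> sum a U * ln (sum a U)"
proof -
  have "(\<Sum>u\<in>U. a u * ln (a u)) \<le> (\<Sum>u\<in>U. a u * ln (sum a U))"
  proof (intro sum_mono)
    fix u assume u: "u \<in> U"
    have "a u \<le> sum a U" using u fin nn by (intro member_le_sum) auto
    then show "a u * ln (a u) \<le> a u * ln (sum a U)"
      using nn[OF u] by (cases "a u = 0") (auto intro!: mult_left_mono)
  qed
  then show ?thesis by (simp flip: sum_distrib_right)
qed

text \<open>Gibbs' inequality against the uniform distribution on K points: ln t \<le> t - 1 at t =
  A / (K a u), weighted by a u and summed.\<close>

lemma sum_entropy_ge:
  fixes a :: "'a \<Rightarrow> real"
  assumes fin: "finite U" and nn: "\<And>u. u \<in> U \<Longrightarrow> 0 \<le> a u"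
    and K: "real (card U) \<le> K" "0 < sum a U"
  shows "sum a U * ln (sum a U) - sum a U * ln K \<le> (\<Sum>u\<in>U. a u * ln (a u))"
proof -
  define A where "A = sum a U"
  have A: "0 < A" using K by (simp add: A_def)
  have "U \<noteq> {}" using K by auto
  then have K0: "0 < K" using K fin by (metis card_gt_0_iff of_nat_0_less_iff order_less_le_trans)
  have "(\<Sum>u\<in>U. a u * (ln A - ln K) - a u * ln (a u)) \<le> (\<Sum>u\<in>U. A / K - a u)"
  proof (intro sum_mono)
    fix u assume u: "u \<in> U"
    show "a u * (ln A - ln K) - a u * ln (a u) \<le> A / K - a u"
    proof (cases "a u = 0")
      case False
      then have "0 < a u" using nn[OF u] by simp
      then have "a u * ln (A / (K * a u)) \<le> a u * (A / (K * a u) - 1)"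
        using A K0 by (intro mult_left_mono ln_le_minus_one) auto
      then show ?thesis using \<open>0 < a u\<close> A K0
        by (simp add: ln_div ln_mult algebra_simps)
    qed (use A K0 in auto)
  qed
  also have "\<dots> = real (card U) * (A / K) - A" by (simp add: sum_subtractf A_def)
  also have "\<dots> \<le> K * (A / K) - A" using K A K0 by (intro diff_right_mono mult_right_mono) auto
  also have "\<dots> = 0" using K0 by simp
  finally have "A * (ln A - ln K) - (\<Sum>u\<in>U. a u * ln (a u)) \<le> 0"
    by (simp add: sum_subtractf A_def flip: sum_distrib_right)
  then show ?thesis by (simp add: A_def right_diff_distrib)
qed

section \<open>Normalised power sums, and row and column sums of a matrix\<close>

definition pterm :: "real \<Rightarrow> real \<Rightarrow> real" where
  "pterm q x = (if q = 1 then x * ln x else x powr q)"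

text \<open>The factor \<open>1 / (q - 1)\<close> is included, so that \<open>dim_quotient\<close> has denominator \<open>ln r\<close> for
  all \<open>q\<close>.\<close>

definition log_sum :: "real \<Rightarrow> real \<Rightarrow> real" where
  "log_sum q S = (if q = 1 then S else ln S / (q - 1))"

lemma sum_powr_pos:
  fixes a :: "'a \<Rightarrow> real"
  assumes "finite U" "\<And>u. u \<in> U \<Longrightarrow> 0 \<le> a u" "0 < sum a U"
  shows "0 < (\<Sum>u\<in>U. a u powr q)"
proof -
  obtain u where "u \<in> U" "a u \<noteq> 0" using assms(3) by (metis less_irrefl sum.neutral)
  then show ?thesis using assms by (intro sum_pos2[of U u]) auto
qed

text \<open>A single atom attains the upper bound and N equal masses the lower one. The power mean
  inequalities are reversed for q < 1, and division by the negative q - 1 reverses them back, so one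
  statement covers both ranges. At q = 1 the fraction is 0, in agreement with total mass 1.\<close>

lemma log_sum_bounds:
  fixes a :: "'a \<Rightarrow> real"
  assumes fin: "finite U" and nn: "\<And>u. u \<in> U \<Longrightarrow> 0 \<le> a u" and A: "0 < sum a U"
    and N: "real (card U) \<le> N" and q: "0 < q" "q = 1 \<longrightarrow> sum a U = 1"
  shows "log_sum q (\<Sum>u\<in>U. pterm q (a u)) \<le> q * ln (sum a U) / (q - 1)"
    and "q * ln (sum a U) / (q - 1) - ln N \<le> log_sum q (\<Sum>u\<in>U. pterm q (a u))"
proof -
  define S where "S = (\<Sum>u\<in>U. a u powr q)"
  have S: "0 < S" unfolding S_def by (rule sum_powr_pos[OF fin nn A])
  have "U \<noteq> {}" using A by auto
  then have N0: "0 < N" using N fin by (metis card_gt_0_iff of_nat_0_less_iff order_less_le_trans)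
  have ln1: "ln (N powr (1 - q) * sum a U powr q) = (1 - q) * ln N + q * ln (sum a U)"
    using N0 A by (simp add: ln_mult)
  have ln2: "ln (sum a U powr q) = q * ln (sum a U)" using A by simp
  consider "q = 1" | "1 < q" | "q < 1" by linarith
  then have "log_sum q (\<Sum>u\<in>U. pterm q (a u)) \<le> q * ln (sum a U) / (q - 1) \<and>
     q * ln (sum a U) / (q - 1) - ln N \<le> log_sum q (\<Sum>u\<in>U. pterm q (a u))"
  proof cases
    case 1
    then have [simp]: "sum a U = 1" using q by simp
    have "(\<Sum>u\<in>U. a u * ln (a u)) \<le> 0"
      using sum_entropy_le[of U a, OF fin nn] by simp
    moreover have "- ln N \<le> (\<Sum>u\<in>U. a u * ln (a u))"
      using sum_entropy_ge[OF fin nn N A] by simp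
    ultimately show ?thesis using 1 by (simp add: log_sum_def pterm_def)
  next
    case 2
    have "ln S \<le> ln (sum a U powr q)"
      using sum_powr_le_powr_sum[of U a, OF fin nn 2] S unfolding S_def[symmetric]
      by (intro ln_mono) auto
    moreover have "ln (N powr (1 - q) * sum a U powr q) \<le> ln S"
      using sum_le_sum_powr[of U a, OF fin nn 2 N A] A N0 unfolding S_def[symmetric]
      by (intro ln_mono) auto
    ultimately have "ln S / (q - 1) \<le> q * ln (sum a U) / (q - 1)"
      "((1 - q) * ln N + q * ln (sum a U)) / (q - 1) \<le> ln S / (q - 1)"
      unfolding ln1 ln2 using 2 by (auto intro!: divide_right_mono)
    then show ?thesis
      using 2 unfolding log_sum_def pterm_def by (simp add: S_def add_divide_distrib field_split_simps)
  next
    case 3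
    have "ln (sum a U powr q) \<le> ln S"
      using powr_sum_le_sum_powr[of U a, OF fin nn q(1) 3] A unfolding S_def[symmetric]
      by (intro ln_mono) auto
    moreover have "ln S \<le> ln (N powr (1 - q) * sum a U powr q)"
      using sum_powr_le_sum[of U a, OF fin nn q(1) 3 N A] S unfolding S_def[symmetric]
      by (intro ln_mono) auto
    ultimately have "ln S / (q - 1) \<le> q * ln (sum a U) / (q - 1)"
      "((1 - q) * ln N + q * ln (sum a U)) / (q - 1) \<le> ln S / (q - 1)"
      unfolding ln1 ln2 using 3 by (auto intro!: divide_right_mono_neg)
    then show ?thesis
      using 3 unfolding log_sum_def pterm_def by (simp add: S_def add_divide_distrib field_split_simps)
  qed
  then show "log_sum q (\<Sum>u\<in>U. pterm q (a u)) \<le> q * ln (sum a U) / (q - 1)"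
    and "q * ln (sum a U) / (q - 1) - ln N \<le> log_sum q (\<Sum>u\<in>U. pterm q (a u))" by auto
qed

text \<open>Zero terms contribute to none of the sums, so K need only count the support; the index
  set may be all relevant cubes while K is the multiplicity of one row.\<close>

lemma row_bounds:
  fixes a :: "'a \<Rightarrow> real"
  assumes fin: "finite U" and nn: "\<And>u. u \<in> U \<Longrightarrow> 0 \<le> a u"
    and K: "real (card {u \<in> U. a u \<noteq> 0}) \<le> K"
  shows "1 < q \<Longrightarrow> K powr (1 - q) * sum a U powr q \<le> (\<Sum>u\<in>U. a u powr q)"
    and "0 < q \<Longrightarrow> q < 1 \<Longrightarrow> (\<Sum>u\<in>U. a u powr q) \<le> K powr (1 - q) * sum a U powr q"
    and "sum a U * ln (sum a U) - sum a U * ln K \<le> (\<Sum>u\<in>U. a u * ln (a u))"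
proof -
  define U' where "U' = {u \<in> U. a u \<noteq> 0}"
  have s: "sum a U = sum a U'" "(\<Sum>u\<in>U. a u powr q) = (\<Sum>u\<in>U'. a u powr q)" for q
    using fin by (auto simp: U'_def intro!: sum.mono_neutral_right)
  have s3: "(\<Sum>u\<in>U. a u * ln (a u)) = (\<Sum>u\<in>U'. a u * ln (a u))"
    using fin by (auto simp: U'_def intro!: sum.mono_neutral_right)
  have U': "finite U'" "\<And>u. u \<in> U' \<Longrightarrow> 0 \<le> a u" "real (card U') \<le> K"
    using fin nn K by (auto simp: U'_def)
  have A0: "0 \<le> sum a U'" by (intro sum_nonneg U'(2))
  show "K powr (1 - q) * sum a U powr q \<le> (\<Sum>u\<in>U. a u powr q)" if "1 < q"
  proof (cases "sum a U' = 0")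
    case False
    with A0 have "0 < sum a U'" by simp
    from sum_le_sum_powr[OF U'(1,2) that U'(3) this] show ?thesis unfolding s .
  qed (simp add: s sum_nonneg)
  have z: "U' = {}" if "sum a U' = 0"
  proof -
    have "\<forall>u\<in>U'. a u = 0" using that sum_nonneg_eq_0_iff[of U' a, OF U'(1,2)] by simp
    then show ?thesis unfolding U'_def by blast
  qed
  show "(\<Sum>u\<in>U. a u powr q) \<le> K powr (1 - q) * sum a U powr q" if "0 < q" "q < 1"
  proof (cases "sum a U' = 0")
    case False
    with A0 have "0 < sum a U'" by simp
    from sum_powr_le_sum[OF U'(1,2) that U'(3) this] show ?thesis unfolding s .
  next
    case True
    from z[OF this] show ?thesis by (simp add: s)
  qed
  show "sum a U * ln (sum a U) - sum a U * ln K \<le> (\<Sum>u\<in>U. a u * ln (a u))"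
  proof (cases "sum a U' = 0")
    case False
    with A0 have "0 < sum a U'" by simp
    from sum_entropy_ge[OF U' this] show ?thesis unfolding s s3 .
  next
    case True
    from z[OF this] show ?thesis by (simp add: s s3)
  qed
qed

text \<open>Breaking each row sum into its entries can only lower \<open>log_sum\<close>, as for a
  refinement of a partition, and by at most ln K since a row has at most K nonzero entries.\<close>

lemma log_sum_rows:
  fixes m :: "'a \<Rightarrow> 'b \<Rightarrow> real"
  assumes fin: "finite U" "finite V" and nn: "\<And>u v. u \<in> U \<Longrightarrow> v \<in> V \<Longrightarrow> 0 \<le> m u v"
    and K: "\<And>u. u \<in> U \<Longrightarrow> real (card {v \<in> V. m u v \<noteq> 0}) \<le> K" "0 < K"
    and q: "0 < q" and A: "0 < (\<Sum>u\<in>U. \<Sum>v\<in>V. m u v)"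
    and q1: "q = 1 \<longrightarrow> (\<Sum>u\<in>U. \<Sum>v\<in>V. m u v) = 1"
  defines "G \<equiv> log_sum q (\<Sum>u\<in>U. \<Sum>v\<in>V. pterm q (m u v))"
    and "R \<equiv> log_sum q (\<Sum>u\<in>U. pterm q (\<Sum>v\<in>V. m u v))"
  shows "G \<le> R" "R \<le> G + ln K"
proof -
  define r where "r u = (\<Sum>v\<in>V. m u v)" for u
  define S where "S = (\<Sum>u\<in>U. r u powr q)"
  define T where "T = (\<Sum>u\<in>U. \<Sum>v\<in>V. m u v powr q)"
  have rnn: "0 \<le> r u" if "u \<in> U" for u using nn that by (auto simp: r_def sum_nonneg)
  have S: "0 < S" unfolding S_def
    by (rule sum_powr_pos) (use fin rnn A in \<open>auto simp: r_def\<close>)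
  have A': "0 < sum (\<lambda>(u,v). m u v) (U \<times> V)" using A by (simp add: sum.cartesian_product)
  have "0 < (\<Sum>p\<in>U\<times>V. (\<lambda>(u,v). m u v) p powr q)"
    by (rule sum_powr_pos) (use fin nn A' in auto)
  then have T: "0 < T" by (simp add: T_def sum.cartesian_product case_prod_unfold)
  consider "q = 1" | "1 < q" | "q < 1" by linarith
  then have "G \<le> R \<and> R \<le> G + ln K"
  proof cases
    case 1
    have "(\<Sum>u\<in>U. \<Sum>v\<in>V. m u v * ln (m u v)) \<le> (\<Sum>u\<in>U. r u * ln (r u))"
      unfolding r_def using fin nn by (intro sum_mono sum_entropy_le) auto
    moreover have "(\<Sum>u\<in>U. r u * ln (r u) - r u * ln K) \<le> (\<Sum>u\<in>U. \<Sum>v\<in>V. m u v * ln (m u v))"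
      unfolding r_def using fin nn K by (intro sum_mono row_bounds(3)) auto
    \<comment> \<open>Total mass 1 makes the row losses \<open>r u * ln K\<close> add up to exactly
      ln K.\<close>
    moreover have "(\<Sum>u\<in>U. r u * ln (r u) - r u * ln K) = (\<Sum>u\<in>U. r u * ln (r u)) - ln K"
      using q1 1 by (simp add: sum_subtractf r_def flip: sum_distrib_right)
    ultimately show ?thesis
      using 1 by (simp add: G_def R_def log_sum_def pterm_def r_def)
  next
    case 2
    have "T \<le> S"
      unfolding T_def S_def r_def using fin nn 2 by (intro sum_mono sum_powr_le_powr_sum) auto
    moreover have "(\<Sum>u\<in>U. K powr (1 - q) * r u powr q) \<le> T"
      unfolding T_def r_def using fin nn K 2 by (intro sum_mono row_bounds(1)) auto
    then have "K powr (1 - q) * S \<le> T" by (simp add: S_def sum_distrib_left)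
    ultimately have "ln T \<le> ln S" "ln (K powr (1 - q) * S) \<le> ln T"
      using S T K by (auto intro!: ln_mono)
    then have "ln T \<le> ln S" "(1 - q) * ln K + ln S \<le> ln T"
      using S K by (auto simp: ln_mult)
    then have "ln T / (q - 1) \<le> ln S / (q - 1)" "((1 - q) * ln K + ln S) / (q - 1) \<le> ln T / (q - 1)"
      using 2 by (auto intro!: divide_right_mono)
    \<comment> \<open>The exponent 1 - q cancels against the normalisation, so the loss ln K does
      not depend on q.\<close>
    moreover have "((1 - q) * ln K + ln S) / (q - 1) = ln S / (q - 1) - ln K"
      using 2 by (simp add: field_simps)
    ultimately show ?thesis
      using 2 by (simp add: G_def R_def log_sum_def pterm_def r_def S_def T_def)
  next
    case 3
    have "S \<le> T"
      unfolding T_def S_def r_def using fin nn 3 q by (intro sum_mono powr_sum_le_sum_powr) auto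
    moreover have "T \<le> (\<Sum>u\<in>U. K powr (1 - q) * r u powr q)"
      unfolding T_def r_def using fin nn K 3 q by (intro sum_mono row_bounds(2)) auto
    then have "T \<le> K powr (1 - q) * S" by (simp add: S_def sum_distrib_left)
    ultimately have "ln S \<le> ln T" "ln T \<le> ln (K powr (1 - q) * S)"
      using S T K by (auto intro!: ln_mono)
    then have "ln S \<le> ln T" "ln T \<le> (1 - q) * ln K + ln S"
      using S K by (auto simp: ln_mult)
    then have "ln T / (q - 1) \<le> ln S / (q - 1)" "((1 - q) * ln K + ln S) / (q - 1) \<le> ln T / (q - 1)"
      using 3 by (auto intro!: divide_right_mono_neg)
    moreover have "((1 - q) * ln K + ln S) / (q - 1) = ln S / (q - 1) - ln K"
      using 3 by (simp add: field_simps)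
    ultimately show ?thesis
      using 3 by (simp add: G_def R_def log_sum_def pterm_def r_def S_def T_def)
  qed
  then show "G \<le> R" "R \<le> G + ln K" by auto
qed

text \<open>The sum over all entries is symmetric in the two indices, and both marginals lie between
  its \<open>log_sum\<close> and that plus ln K.\<close>

lemma log_sum_rows_columns:
  fixes m :: "'a \<Rightarrow> 'b \<Rightarrow> real"
  assumes fin: "finite U" "finite V" and nn: "\<And>u v. u \<in> U \<Longrightarrow> v \<in> V \<Longrightarrow> 0 \<le> m u v"
    and K: "\<And>u. u \<in> U \<Longrightarrow> real (card {v \<in> V. m u v \<noteq> 0}) \<le> K"
      "\<And>v. v \<in> V \<Longrightarrow> real (card {u \<in> U. m u v \<noteq> 0}) \<le> K" "0 < K"
    and q: "0 < q" and A: "0 < (\<Sum>u\<in>U. \<Sum>v\<in>V. m u v)"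
    and q1: "q = 1 \<longrightarrow> (\<Sum>u\<in>U. \<Sum>v\<in>V. m u v) = 1"
  shows "\<bar>log_sum q (\<Sum>u\<in>U. pterm q (\<Sum>v\<in>V. m u v))
           - log_sum q (\<Sum>v\<in>V. pterm q (\<Sum>u\<in>U. m u v))\<bar> \<le> ln K"
proof -
  have sw: "(\<Sum>u\<in>U. \<Sum>v\<in>V. f u v) = (\<Sum>v\<in>V. \<Sum>u\<in>U. f u v)" for f :: "'a \<Rightarrow> 'b \<Rightarrow> real"
    by (rule sum.swap)
  have "log_sum q (\<Sum>u\<in>U. \<Sum>v\<in>V. pterm q (m u v)) \<le> log_sum q (\<Sum>u\<in>U. pterm q (\<Sum>v\<in>V. m u v))"
    "log_sum q (\<Sum>u\<in>U. pterm q (\<Sum>v\<in>V. m u v)) \<le> log_sum q (\<Sum>u\<in>U. \<Sum>v\<in>V. pterm q (m u v)) + ln K"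
    by (rule log_sum_rows[OF fin nn K(1,3) q A q1]; assumption)+
  moreover have "log_sum q (\<Sum>v\<in>V. \<Sum>u\<in>U. pterm q (m u v)) \<le> log_sum q (\<Sum>v\<in>V. pterm q (\<Sum>u\<in>U. m u v))"
    "log_sum q (\<Sum>v\<in>V. pterm q (\<Sum>u\<in>U. m u v)) \<le> log_sum q (\<Sum>v\<in>V. \<Sum>u\<in>U. pterm q (m u v)) + ln K"
    by (rule log_sum_rows[OF fin(2,1) nn K(2,3) q A[unfolded sw] q1[unfolded sw]]; assumption)+
  ultimately show ?thesis by (simp add: sw[of "\<lambda>u v. pterm q (m u v)"])
qed

section \<open>Critical exponents\<close>

lemma eventually_ln_le: "\<forall>\<^sub>F r in at_right (0::real). ln r \<le> B"
  using ln_at_0 by (simp add: filterlim_at_bot)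

lemma eventually_unit_interval: "\<forall>\<^sub>F r in at_right (0::real). 0 < r \<and> r < 1"
  using eventually_at_right_real[of 0 1] by simp

text \<open>Since ln r tends to -\<infinity>, the gap (s - t) * ln r swallows the constant B.
  Division by ln r < 0 turns the upper bound on h into a lower bound on the quotient.\<close>

lemma eventually_less_ln_quotient:
  assumes "t < s"
  shows "\<forall>\<^sub>F r in at_right (0::real). h r - s * ln r \<le> B \<longrightarrow> t \<le> h r / ln r"
  using eventually_unit_interval eventually_ln_le[of "- \<bar>B\<bar> / (s - t)"]
proof eventually_elim
  case (elim r)
  have "ln r < 0" using elim by simp
  have "(s - t) * ln r \<le> - \<bar>B\<bar>" using elim assms by (simp add: field_simps)
  then have "h r - s * ln r \<le> B \<longrightarrow> h r \<le> t * ln r" by (simp add: left_diff_distrib) linarith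
  then show ?case using \<open>ln r < 0\<close> by (simp add: le_divide_eq)
qed

lemma ereal_le_lt_real:
  assumes "\<And>t. t < s \<Longrightarrow> ereal t \<le> X"
  shows "ereal s \<le> X"
proof (rule dense_le)
  fix x assume "x < ereal s"
  then show "x \<le> X"
    by (cases x) (use assms in auto)
qed

lemma le_Liminf_ln_quotient:
  assumes "\<forall>\<^sub>F r in at_right (0::real). h r - s * ln r \<le> B"
  shows "ereal s \<le> Liminf (at_right 0) (\<lambda>r. ereal (h r / ln r))"
proof (rule ereal_le_lt_real)
  fix t assume "t < s"
  show "ereal t \<le> Liminf (at_right 0) (\<lambda>r. ereal (h r / ln r))"
    using eventually_less_ln_quotient[OF \<open>t < s\<close>, of h B] assms
    by (intro Liminf_bounded) (auto elim: eventually_elim2)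
qed

lemma le_Limsup_ln_quotient:
  assumes "\<exists>\<^sub>F r in at_right (0::real). h r - s * ln r \<le> B"
  shows "ereal s \<le> Limsup (at_right 0) (\<lambda>r. ereal (h r / ln r))"
proof (rule ereal_le_lt_real)
  fix t assume "t < s"
  show "ereal t \<le> Limsup (at_right 0) (\<lambda>r. ereal (h r / ln r))"
  proof (rule ccontr)
    assume "\<not> ?thesis"
    then have "\<forall>\<^sub>F r in at_right 0. ereal (h r / ln r) < ereal t"
      by (intro Limsup_lessD) simp
    then have "\<forall>\<^sub>F r in at_right 0. \<not> h r - s * ln r \<le> B"
      using eventually_less_ln_quotient[OF \<open>t < s\<close>, of h B] by (auto elim: eventually_elim2)
    then show False using assms by (simp add: frequently_def)
  qed
qed

lemma less_Liminf_ln_quotient: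
  assumes "ereal t < Liminf (at_right 0) (\<lambda>r. ereal (h r / ln r))"
  shows "\<forall>\<^sub>F r in at_right (0::real). h r - t * ln r \<le> 0"
  using less_LiminfD[OF assms] eventually_unit_interval
  by eventually_elim (auto simp: less_divide_eq)

lemma less_Limsup_ln_quotient:
  assumes "ereal t < Limsup (at_right 0) (\<lambda>r. ereal (h r / ln r))"
  shows "\<exists>\<^sub>F r in at_right (0::real). h r - t * ln r \<le> 0"
proof (rule ccontr)
  assume "\<not> ?thesis"
  then have "\<forall>\<^sub>F r in at_right (0::real). \<not> h r - t * ln r \<le> 0" by (simp add: frequently_def)
  then have "\<forall>\<^sub>F r in at_right (0::real). ereal (h r / ln r) \<le> ereal t"
    using eventually_unit_interval by eventually_elim (auto simp: divide_le_eq)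
  from Limsup_bounded[OF this] assms show False by simp
qed

text \<open>P is only known to hold strictly below X and to fail strictly above it; what happens at
  X itself is left open, and the inserted 0 covers X = 0.\<close>

lemma Sup_positive_exponents:
  fixes X :: ereal
  assumes "0 \<le> X" and "\<And>s. 0 < s \<Longrightarrow> P s \<Longrightarrow> ereal s \<le> X" and "\<And>s. 0 < s \<Longrightarrow> ereal s < X \<Longrightarrow> P s"
  shows "Sup (insert 0 (ereal ` {s. 0 < s \<and> P s})) = X"
proof (rule antisym)
  show "X \<le> Sup (insert 0 (ereal ` {s. 0 < s \<and> P s}))"
  proof (rule dense_le)
    fix y assume y: "y < X"
    show "y \<le> Sup (insert 0 (ereal ` {s. 0 < s \<and> P s}))"
    proof (cases "y \<le> 0")
      case False
      then obtain s where "y = ereal s" "0 < s" using y by (cases y) auto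
      then show ?thesis using assms(3) y by (intro Sup_upper) auto
    qed (rule Sup_upper2[of 0], auto)
  qed
qed (use assms in \<open>auto intro!: Sup_least\<close>)

lemma Inf_positive_exponents:
  fixes X :: ereal
  assumes "0 \<le> X" and "\<And>s. 0 < s \<Longrightarrow> P s \<Longrightarrow> X \<le> ereal s" and "\<And>s. 0 < s \<Longrightarrow> X < ereal s \<Longrightarrow> P s"
  shows "Inf (ereal ` {s. 0 < s \<and> P s}) = X"
proof (rule antisym)
  show "Inf (ereal ` {s. 0 < s \<and> P s}) \<le> X"
  proof (rule dense_ge)
    fix y assume y: "X < y"
    show "Inf (ereal ` {s. 0 < s \<and> P s}) \<le> y"
    proof (cases y)
      case (real s)
      then have "0 < s" using y assms(1) by (metis ereal_less(2) order_le_less_trans)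
      then show ?thesis using assms(3) y real by (intro Inf_lower) auto
    qed (use y in auto)
  qed
qed (use assms in \<open>auto intro!: Inf_greatest\<close>)

section \<open>Finite upper and lower limits as boundedness\<close>

lemma Limsup_ereal_finite_iff:
  fixes f :: "'a \<Rightarrow> real"
  shows "Limsup F (\<lambda>r. ereal (f r)) < \<infinity> \<longleftrightarrow> (\<exists>B. \<forall>\<^sub>F r in F. f r \<le> B)"
proof
  assume "Limsup F (\<lambda>r. ereal (f r)) < \<infinity>"
  then obtain B where "Limsup F (\<lambda>r. ereal (f r)) < ereal B"
    by (metis ereal_dense2)
  from Limsup_lessD[OF this] show "\<exists>B. \<forall>\<^sub>F r in F. f r \<le> B"
    by (auto elim!: eventually_mono intro!: exI[of _ B])
next
  assume "\<exists>B. \<forall>\<^sub>F r in F. f r \<le> B"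
  then obtain B where "\<forall>\<^sub>F r in F. ereal (f r) \<le> ereal B" by auto
  from Limsup_bounded[OF this] show "Limsup F (\<lambda>r. ereal (f r)) < \<infinity>"
    by (rule le_less_trans) simp
qed

text \<open>A finite liminf means boundedness that recurs but need not persist, hence
  \<open>frequently\<close> in place of \<open>eventually\<close>. The two critical values differ
  only in this quantifier.\<close>

lemma Liminf_ereal_finite_iff:
  fixes f :: "'a \<Rightarrow> real"
  shows "Liminf F (\<lambda>r. ereal (f r)) < \<infinity> \<longleftrightarrow> (\<exists>B. \<exists>\<^sub>F r in F. f r \<le> B)"
proof
  assume "Liminf F (\<lambda>r. ereal (f r)) < \<infinity>"
  then obtain B where B: "Liminf F (\<lambda>r. ereal (f r)) < ereal B"
    by (metis ereal_dense2)
  have "\<not> (\<forall>\<^sub>F r in F. \<not> f r \<le> B)"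
  proof
    assume "\<forall>\<^sub>F r in F. \<not> f r \<le> B"
    then have "\<forall>\<^sub>F r in F. ereal B \<le> ereal (f r)" by eventually_elim auto
    from Liminf_bounded[OF this] B show False by simp
  qed
  then show "\<exists>B. \<exists>\<^sub>F r in F. f r \<le> B" by (auto simp: frequently_def)
next
  assume "\<exists>B. \<exists>\<^sub>F r in F. f r \<le> B"
  then obtain B where B: "\<exists>\<^sub>F r in F. f r \<le> B" by auto
  have "\<not> ereal B < Liminf F (\<lambda>r. ereal (f r))"
  proof
    assume "ereal B < Liminf F (\<lambda>r. ereal (f r))"
    from less_LiminfD[OF this] B show False by (auto simp: frequently_def not_le)
  qed
  then show "Liminf F (\<lambda>r. ereal (f r)) < \<infinity>"
    by (metis ereal_infty_less(1) not_less order_le_less_trans ereal.distinct(1) less_ereal.simps(4))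
qed

section \<open>Counting separated points and mesh cubes\<close>

lemma card_int_box:
  fixes B :: "'d::finite \<Rightarrow> int set"
  assumes "\<And>i. finite (B i)" "\<And>i. real (card (B i)) \<le> N"
  shows "finite {j::int^'d. \<forall>i. j $ i \<in> B i}"
    and "real (card {j::int^'d. \<forall>i. j $ i \<in> B i}) \<le> N ^ CARD('d)"
proof -
  have sub: "{j::int^'d. \<forall>i. j $ i \<in> B i} \<subseteq> vec_lambda ` (PiE UNIV B)"
  proof
    fix j :: "int^'d" assume "j \<in> {j. \<forall>i. j $ i \<in> B i}"
    then have "vec_nth j \<in> PiE UNIV B" by auto
    then show "j \<in> vec_lambda ` (PiE UNIV B)"
      by (metis image_eqI vec_nth_inverse)
  qed
  have fin: "finite (PiE UNIV B)" using assms by (intro finite_PiE) auto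
  show "finite {j::int^'d. \<forall>i. j $ i \<in> B i}"
    using sub fin by (meson finite_imageI finite_subset)
  have "card {j::int^'d. \<forall>i. j $ i \<in> B i} \<le> card (PiE UNIV B)"
    using sub fin by (rule surj_card_le[rotated])
  also have "\<dots> = (\<Prod>i\<in>UNIV. card (B i))" by (rule card_PiE) simp
  finally have "real (card {j::int^'d. \<forall>i. j $ i \<in> B i}) \<le> (\<Prod>i\<in>UNIV. real (card (B i)))"
    by (simp only: of_nat_prod[symmetric] of_nat_le_iff)
  also have "\<dots> \<le> (\<Prod>i\<in>(UNIV::'d set). N)" using assms by (intro prod_mono) auto
  finally show "real (card {j::int^'d. \<forall>i. j $ i \<in> B i}) \<le> N ^ CARD('d)" by simp
qed

text \<open>Index of the mesh cube of side \<delta> containing x. It is injective on well separated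
  points and its fibres are the mesh cubes, so one estimate of its image counts both.\<close>

definition floor_vec :: "real \<Rightarrow> real^'d \<Rightarrow> int^'d" where
  "floor_vec \<delta> x = (\<chi> i. \<lfloor>x $ i / \<delta>\<rfloor>)"

lemma card_floor_vec:
  fixes X :: "(real^'d) set"
  assumes X: "X \<subseteq> cball p L" and \<delta>: "0 < \<delta>" and L: "0 \<le> L"
  shows "finite (floor_vec \<delta> ` X)" "real (card (floor_vec \<delta> ` X)) \<le> (2 * L / \<delta> + 2) ^ CARD('d)"
proof -
  define B where "B i = {\<lfloor>(p $ i - L) / \<delta>\<rfloor>..\<lfloor>(p $ i + L) / \<delta>\<rfloor>}" for i
  have sub: "floor_vec \<delta> ` X \<subseteq> {j. \<forall>i. j $ i \<in> B i}"
  proof safe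
    fix x i assume "x \<in> X"
    then have "\<bar>(p - x) $ i\<bar> \<le> L"
      using X component_le_norm_cart[of "p - x" i] by (auto simp: dist_norm)
    then show "floor_vec \<delta> x $ i \<in> B i"
      using \<delta> by (auto simp: floor_vec_def B_def intro!: floor_mono divide_right_mono)
  qed
  have "real (card (B i)) \<le> 2 * L / \<delta> + 2" for i
  proof -
    \<comment> \<open>Rounding the lower end down costs less than 1 and counting both ends costs 1,
      whence the summand 2.\<close>
    have "real_of_int \<lfloor>(p $ i + L) / \<delta>\<rfloor> - real_of_int \<lfloor>(p $ i - L) / \<delta>\<rfloor> + 1
        \<le> (p $ i + L) / \<delta> - ((p $ i - L) / \<delta> - 1) + 1"
      by linarith
    also have "\<dots> = 2 * L / \<delta> + 2" using \<delta> by (simp add: field_simps)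
    moreover have "0 \<le> 2 * L / \<delta> + 2" using L \<delta> by (simp add: add_nonneg_nonneg)
    ultimately show ?thesis by (simp add: B_def of_nat_nat)
  qed
  moreover have "finite (B i)" for i by (simp add: B_def)
  ultimately have box: "finite {j. \<forall>i. j $ i \<in> B i}"
    "real (card {j. \<forall>i. j $ i \<in> B i}) \<le> (2 * L / \<delta> + 2) ^ CARD('d)"
    by (auto intro: card_int_box)
  show "finite (floor_vec \<delta> ` X)" using sub box(1) by (rule finite_subset)
  show "real (card (floor_vec \<delta> ` X)) \<le> (2 * L / \<delta> + 2) ^ CARD('d)"
    using card_mono[OF box(1) sub] box(2) by linarith
qed

text \<open>Points sharing a cube of side \<delta> differ by less than \<delta> in each coordinate,
  hence by less than \<open>CARD('d) * \<delta>\<close> in the 1-norm, which dominates the distance;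
  so \<open>floor_vec\<close> is injective on X.\<close>

lemma card_separated_points:
  fixes X :: "(real^'d) set"
  assumes X: "X \<subseteq> cball p L" and \<delta>: "0 < \<delta>" and L: "0 \<le> L"
    and sep: "\<And>x y. x \<in> X \<Longrightarrow> y \<in> X \<Longrightarrow> x \<noteq> y \<Longrightarrow> real CARD('d) * \<delta> \<le> dist x y"
  shows "finite X" "real (card X) \<le> (2 * L / \<delta> + 2) ^ CARD('d)"
proof -
  have inj: "inj_on (floor_vec \<delta>) X"
  proof (rule inj_onI, rule ccontr)
    fix x y assume xy: "x \<in> X" "y \<in> X" "floor_vec \<delta> x = floor_vec \<delta> y" "x \<noteq> y"
    have "\<bar>x $ i - y $ i\<bar> < \<delta>" for i
    proof -
      have "\<lfloor>x $ i / \<delta>\<rfloor> = \<lfloor>y $ i / \<delta>\<rfloor>"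
        using xy(3) by (auto simp: floor_vec_def vec_eq_iff)
      then have "\<bar>x $ i / \<delta> - y $ i / \<delta>\<bar> < 1" by linarith
      then show ?thesis using \<delta> by (simp add: field_simps abs_less_iff flip: diff_divide_distrib)
    qed
    then have "(\<Sum>i\<in>UNIV. \<bar>(x - y) $ i\<bar>) < (\<Sum>i\<in>(UNIV::'d set). \<delta>)"
      by (intro sum_strict_mono) auto
    then have "dist x y < real CARD('d) * \<delta>"
      using norm_le_l1_cart[of "x - y"] by (simp add: dist_norm)
    then show False using sep[of x y] xy by simp
  qed
  show "finite X" using card_floor_vec(1)[OF X \<delta> L] inj by (rule finite_imageD)
  show "real (card X) \<le> (2 * L / \<delta> + 2) ^ CARD('d)"
    using card_floor_vec(2)[OF X \<delta> L] by (simp add: card_image[OF inj])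
qed

section \<open>Half-open mesh cubes\<close>

definition mesh_cube :: "real \<Rightarrow> int^'d \<Rightarrow> (real^'d) set" where
  "mesh_cube r j = {x. \<forall>i. of_int (j $ i) * r \<le> x $ i \<and> x $ i < (of_int (j $ i) + 1) * r}"

lemma mesh_cubes_eq: "mesh_cubes r = range (mesh_cube r)"
  by (simp add: mesh_cubes_def mesh_cube_def)

lemma mem_mesh_cube_iff: "0 < r \<Longrightarrow> x \<in> mesh_cube r j \<longleftrightarrow> j = floor_vec r x"
  by (auto simp: mesh_cube_def floor_vec_def vec_eq_iff floor_eq_iff le_divide_eq divide_less_eq
      eq_commute[of "j $ _"])

lemma mesh_cubes_disjoint:
  "0 < r \<Longrightarrow> Q \<in> mesh_cubes r \<Longrightarrow> Q' \<in> mesh_cubes r \<Longrightarrow> x \<in> Q \<Longrightarrow> x \<in> Q' \<Longrightarrow> Q = Q'"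
  by (auto simp: mesh_cubes_eq mem_mesh_cube_iff)

lemma mesh_cubes_cover: "0 < r \<Longrightarrow> \<exists>Q\<in>mesh_cubes r. x \<in> Q"
  by (auto simp: mesh_cubes_eq mem_mesh_cube_iff)

lemma card_mesh_cubes_meeting:
  fixes X :: "(real^'d) set"
  assumes X: "X \<subseteq> cball p L" and r: "0 < r" and L: "0 \<le> L"
  shows "finite {Q \<in> mesh_cubes r. X \<inter> Q \<noteq> {}}"
    and "real (card {Q \<in> mesh_cubes r. X \<inter> Q \<noteq> {}}) \<le> (2 * L / r + 2) ^ CARD('d)"
proof -
  have eq: "{Q \<in> mesh_cubes r. X \<inter> Q \<noteq> {}} = mesh_cube r ` floor_vec r ` X"
    using r by (auto simp: mesh_cubes_eq mem_mesh_cube_iff disjoint_iff)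
  show "finite {Q \<in> mesh_cubes r. X \<inter> Q \<noteq> {}}"
    unfolding eq using card_floor_vec(1)[OF assms] by simp
  show "real (card {Q \<in> mesh_cubes r. X \<inter> Q \<noteq> {}}) \<le> (2 * L / r + 2) ^ CARD('d)"
    unfolding eq using card_image_le[OF card_floor_vec(1)[OF assms], of "mesh_cube r"]
      card_floor_vec(2)[OF assms] by linarith
qed

lemma mesh_cube_dist_le:
  fixes x y :: "real^'d"
  assumes "Q \<in> mesh_cubes r" "x \<in> Q" "y \<in> Q"
  shows "dist x y \<le> real CARD('d) * r"
proof -
  have "\<bar>(x - y) $ i\<bar> \<le> r" for i
    using assms by (auto simp: mesh_cubes_eq mesh_cube_def algebra_simps abs_le_iff)
      (smt (verit, best))+
  then have "(\<Sum>i\<in>UNIV. \<bar>(x - y) $ i\<bar>) \<le> (\<Sum>i\<in>(UNIV::'d set). r)"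
    by (intro sum_mono) auto
  then show ?thesis using norm_le_l1_cart[of "x - y"] by (simp add: dist_norm)
qed

lemma mesh_cubes_borel: "Q \<in> mesh_cubes r \<Longrightarrow> Q \<in> sets borel"
proof -
  assume "Q \<in> mesh_cubes r"
  then obtain j where "Q = (\<Inter>i. {x. of_int (j $ i) * r \<le> x $ i} \<inter> {x. x $ i < (of_int (j $ i) + 1) * r})"
    by (auto simp: mesh_cubes_eq mesh_cube_def)
  moreover have "closed {x::real^'d. t \<le> x $ i}" "open {x::real^'d. x $ i < t}" for i t
    by (intro closed_Collect_le open_Collect_less continuous_intros)+
  ultimately show ?thesis
    by (auto intro!: sets.finite_INT)
qed

section \<open>Words and cut sets\<close>

lemma take_mem_words: "u \<in> words n k \<Longrightarrow> j \<le> k \<Longrightarrow> take j u \<in> words n j"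
  by (auto simp: words_def)

lemma fin_words_iff: "u \<in> fin_words n \<longleftrightarrow> u \<in> words n (length u)"
  by (auto simp: fin_words_def words_def)

lemma take_fin_words: "u \<in> fin_words n \<Longrightarrow> j \<le> length u \<Longrightarrow> take j u \<in> words n j"
  using take_mem_words by (simp add: fin_words_iff)

lemma take_mem_fin_words: "u \<in> fin_words n \<Longrightarrow> take j u \<in> fin_words n"
  by (auto simp: fin_words_iff words_def)

lemma nth_fin_words: "u \<in> fin_words n \<Longrightarrow> j < length u \<Longrightarrow> u ! j \<in> {1..n j}"
  by (simp add: fin_words_iff words_def)

lemma length_prefix_word [simp]: "length (prefix_word w k) = k"
  by (simp add: prefix_word_def)

lemma take_prefix_word: "j \<le> k \<Longrightarrow> take j (prefix_word w k) = prefix_word w j"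
  by (simp add: prefix_word_def take_map take_upt)

lemma prefix_mem_words: "w \<in> inf_words n \<Longrightarrow> prefix_word w k \<in> words n k"
  by (auto simp: words_def inf_words_def prefix_word_def)

lemma prefix_mem_fin_words: "w \<in> inf_words n \<Longrightarrow> prefix_word w k \<in> fin_words n"
  using prefix_mem_words by (simp add: fin_words_iff)

lemma ratio_Nil [simp]: "ratio c [] = 1"
  by (simp add: ratio_def)

lemma ratio_take_Suc: "j < length u \<Longrightarrow> ratio c (take (Suc j) u) = ratio c (take j u) * c j (u ! j)"
  by (simp add: ratio_def)

text \<open>The hypotheses say that neither word is a prefix of the other; the least index of
  disagreement then follows a common prefix.\<close>

lemma first_difference:
  assumes "\<And>j. u \<noteq> take j v" "\<And>j. v \<noteq> take j u"
  obtains j where "j < length u" "j < length v" "take j u = take j v" "u ! j \<noteq> v ! j"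
proof -
  define P where "P j \<longleftrightarrow> j < length u \<and> j < length v \<and> u ! j \<noteq> v ! j" for j
  have ex: "\<exists>j. P j"
  proof (rule ccontr)
    assume "\<not> ?thesis"
    then have "take (min (length u) (length v)) u = take (min (length u) (length v)) v"
      by (intro nth_equalityI) (auto simp: P_def)
    then have "u = take (length u) v \<or> v = take (length v) u"
      by (metis min_def take_all_iff nle_le)
    then show False using assms by blast
  qed
  define j where "j = (LEAST j. P j)"
  have j: "P j" unfolding j_def using ex by (rule LeastI_ex)
  have "take j u = take j v"
  proof (rule nth_equalityI)
    fix i assume "i < length (take j u)"
    then have "i < j" "\<not> P i" using not_less_Least[of i P] by (auto simp: j_def)
    then show "take j u ! i = take j v ! i" using j by (auto simp: P_def)
  qed (use j in \<open>simp add: P_def\<close>)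
  with j show thesis by (intro that[of j]) (simp_all add: P_def)
qed

locale bounded_ratios =
  fixes n :: "nat \<Rightarrow> nat" and c :: "nat \<Rightarrow> nat \<Rightarrow> real" and a b :: real
  assumes a: "0 < a" and b: "b < 1" "0 < b"
    and c: "\<And>k i. i \<in> {1..n k} \<Longrightarrow> a \<le> c k i \<and> c k i \<le> b"
begin

lemma ratio_pos: "u \<in> fin_words n \<Longrightarrow> 0 < ratio c u"
  unfolding ratio_def
proof (intro prod_pos ballI)
  fix j assume "u \<in> fin_words n" "j \<in> {..<length u}"
  then show "0 < c j (u ! j)" using c[of "u ! j" j] a nth_fin_words[of u n j] by simp
qed

lemma ratio_take_mono:
  assumes "u \<in> fin_words n" "i \<le> j"
  shows "ratio c (take j u) \<le> ratio c (take i u)"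
  using \<open>i \<le> j\<close>
proof (induction rule: dec_induct)
  case (step j)
  have "ratio c (take (Suc j) u) \<le> ratio c (take j u)"
  proof (cases "j < length u")
    case True
    then have "c j (u ! j) \<le> 1" using c[of "u ! j" j] nth_fin_words[OF assms(1)] b by fastforce
    then show ?thesis
      using True ratio_pos[OF take_mem_fin_words[OF assms(1)], of j]
      by (simp add: ratio_take_Suc mult_left_le)
  qed simp
  then show ?case using step by linarith
qed simp

lemma ratio_le_power: "u \<in> fin_words n \<Longrightarrow> ratio c u \<le> b ^ length u"
proof -
  assume u: "u \<in> fin_words n"
  have "ratio c u \<le> (\<Prod>j<length u. b)"
    unfolding ratio_def using a c nth_fin_words[OF u]
    by (intro prod_mono) (auto intro: order_trans less_imp_le)
  then show ?thesis by simp
qed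

text \<open>The ratio of \<open>butlast u\<close> still exceeds r, and the last letter multiplies it
  by at least a.\<close>

lemma cut_set_ratio:
  assumes "u \<in> cut_set n c r"
  shows "ratio c u \<le> r" "a * r < ratio c u"
proof -
  show "ratio c u \<le> r" using assms by (simp add: cut_set_def)
  have u: "u \<in> fin_words n" "r < ratio c (butlast u)" "ratio c u \<le> r"
    using assms by (auto simp: cut_set_def)
  \<comment> \<open>\<open>butlast []\<close> is \<open>[]\<close>, so the empty word would satisfy
    two contradictory inequalities.\<close>
  then have "u \<noteq> []" by auto
  then obtain k where k: "length u = Suc k" by (cases u) auto
  have "ratio c u = ratio c (butlast u) * c k (u ! k)"
    using ratio_take_Suc[of k u c] k by (simp add: butlast_conv_take)
  moreover have "a \<le> c k (u ! k)" using c nth_fin_words[OF u(1), of k] k by auto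
  moreover have "0 < ratio c (butlast u)"
    using ratio_pos[OF take_mem_fin_words[OF u(1)], of k] k by (simp add: butlast_conv_take)
  ultimately have "a * ratio c (butlast u) \<le> ratio c u"
    using a by (metis mult.commute mult_left_mono less_imp_le)
  moreover have "a * r < a * ratio c (butlast u)" using a u by simp
  ultimately show "a * r < ratio c u" by linarith
qed

text \<open>A proper prefix of u is a prefix of \<open>butlast u\<close>, whose ratio exceeds r, and
  shorter prefixes have larger ratios.\<close>

lemma cut_set_prefix_free:
  assumes u: "u \<in> cut_set n c r" and v: "v \<in> cut_set n c r" and eq: "v = take j u"
  shows "u = v"
proof (rule ccontr)
  assume "u \<noteq> v"
  then have "\<not> length u \<le> j" using eq by auto
  then have j: "j \<le> length u - 1" by linarith
  have "ratio c (butlast u) \<le> ratio c v"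
    unfolding eq butlast_conv_take using u j by (intro ratio_take_mono) (auto simp: cut_set_def)
  then show False using u v by (auto simp: cut_set_def)
qed

lemma cut_set_cylinder_unique:
  assumes "u \<in> cut_set n c r" "v \<in> cut_set n c r" "w \<in> cylinder n u" "w \<in> cylinder n v"
  shows "u = v"
proof -
  have "u = prefix_word w (length u)" "v = prefix_word w (length v)"
    using assms by (auto simp: cylinder_def)
  then have "u = take (length u) v \<or> v = take (length v) u"
    by (metis take_prefix_word nle_le)
  then show ?thesis using cut_set_prefix_free assms by metis
qed

text \<open>The cut set is a stopping rule: m is the first level at which the ratio of the prefix
  drops to r or below, and it exists because ratios are at most b ^ k.\<close>

lemma cut_set_cylinder_cover:
  assumes r: "0 < r" "r < 1" and w: "w \<in> inf_words n"
  obtains u where "u \<in> cut_set n c r" "w \<in> cylinder n u"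
proof -
  define P where "P k \<longleftrightarrow> ratio c (prefix_word w k) \<le> r" for k
  obtain k where "b ^ k < r" using real_arch_pow_inv[OF r(1) b(1)] by auto
  then have "P k" using ratio_le_power[OF prefix_mem_fin_words[OF w], of k] by (simp add: P_def)
  define m where "m = (LEAST k. P k)"
  have m: "P m" unfolding m_def using \<open>P k\<close> by (rule LeastI)
  \<comment> \<open>Here r < 1 enters: the empty word has ratio 1.\<close>
  have "m \<noteq> 0" using m r by (intro notI) (simp add: P_def prefix_word_def)
  then have "\<not> P (m - 1)" unfolding m_def by (intro not_less_Least) simp
  moreover have "butlast (prefix_word w m) = prefix_word w (m - 1)"
    by (simp add: butlast_conv_take take_prefix_word)
  ultimately have "prefix_word w m \<in> cut_set n c r"
    using m prefix_mem_fin_words[OF w] by (simp add: cut_set_def P_def)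
  moreover have "w \<in> cylinder n (prefix_word w m)" using w by (simp add: cylinder_def)
  ultimately show thesis by (rule that)
qed

end

section \<open>Geometry of the pieces\<close>

lemma foldr_comp_similarity:
  fixes f :: "'b \<Rightarrow> 'a::metric_space \<Rightarrow> 'a"
  assumes "\<And>j. j \<in> set js \<Longrightarrow> surj (f j)"
    and "\<And>j x y. j \<in> set js \<Longrightarrow> dist (f j x) (f j y) = \<rho> j * dist x y"
  shows "surj (foldr (\<circ>) (map f js) id)"
    and "dist (foldr (\<circ>) (map f js) id x) (foldr (\<circ>) (map f js) id y) = (\<Prod>j\<leftarrow>js. \<rho> j) * dist x y"
proof -
  show "surj (foldr (\<circ>) (map f js) id)"
    using assms(1)
  proof (induction js)
    case (Cons j js)
    have "surj (f j)" by (rule Cons.prems) simp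
    moreover have "surj (foldr (\<circ>) (map f js) id)"
      by (rule Cons.IH, rule Cons.prems) simp
    ultimately have "surj (f j \<circ> foldr (\<circ>) (map f js) id)" by (rule comp_surj[rotated])
    moreover have "foldr (\<circ>) (map f (j # js)) id = f j \<circ> foldr (\<circ>) (map f js) id"
      by (simp add: fun_eq_iff)
    ultimately show ?case by (simp only:)
  qed simp
  show "dist (foldr (\<circ>) (map f js) id x) (foldr (\<circ>) (map f js) id y) = (\<Prod>j\<leftarrow>js. \<rho> j) * dist x y"
    using assms(2) by (induction js) simp_all
qed

text \<open>Surjectivity makes the image of a ball a full ball: each point of the target ball has a
  preimage, and scaling distances back puts it into the source ball.\<close>

lemma similarity_image_ball:
  fixes f :: "'a::metric_space \<Rightarrow> 'a"
  assumes "surj f" "\<And>x y. dist (f x) (f y) = t * dist x y" "0 < t"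
  shows "ball (f x) (t * \<rho>) \<subseteq> f ` ball x \<rho>"
proof
  fix y assume y: "y \<in> ball (f x) (t * \<rho>)"
  obtain z where "y = f z" using assms(1) by (meson surjD)
  then show "y \<in> f ` ball x \<rho>" using y assms by auto
qed

locale separated_similar_set = bounded_ratios n c a b
  for n c a b +
  fixes T :: "nat \<Rightarrow> nat \<Rightarrow> real^'d^'d" and \<omega> :: "nat list \<Rightarrow> real^'d"
    and J :: "(real^'d) set" and JJ :: "nat list \<Rightarrow> (real^'d) set"
  assumes J: "compact J" "interior J \<noteq> {}"
    and similarities: "contracting_similarities n T c"
    and struct: "nonautonomous_structure n T \<omega> J JJ"
    and separated: "strong_separation n JJ"
begin

lemma Psi_similarity:
  assumes u: "u \<in> fin_words n" and j: "j < length u"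
  shows "surj (Psi T \<omega> u j)" "dist (Psi T \<omega> u j x) (Psi T \<omega> u j y) = c j (u ! j) * dist x y"
proof -
  define i where "i = u ! j"
  have i: "i \<in> {1..n j}" using nth_fin_words[OF u j] by (simp add: i_def)
  have ci: "0 < c j i" and d: "\<And>x y. norm (T j i *v x - T j i *v y) = c j i * norm (x - y)"
    using similarities i by (auto simp: contracting_similarities_def)
  show "dist (Psi T \<omega> u j x) (Psi T \<omega> u j y) = c j (u ! j) * dist x y"
    using d[of x y] by (simp add: Psi_def dist_norm i_def)
  \<comment> \<open>A positive ratio forces injectivity, and an injective endomorphism of a
    finite-dimensional space is onto.\<close>
  have "inj ((*v) (T j i))"
  proof (rule injI)
    fix x y assume "T j i *v x = T j i *v y"
    with d[of x y] ci show "x = y" by simp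
  qed
  then have surjT: "surj ((*v) (T j i))"
    by (intro linear_inj_imp_surj) auto
  show "surj (Psi T \<omega> u j)"
  proof (rule surjI)
    fix y
    have "T j i *v inv ((*v) (T j i)) (y - \<omega> (take (Suc j) u)) = y - \<omega> (take (Suc j) u)"
      using surjT by (rule surj_f_inv_f)
    then show "Psi T \<omega> u j (inv ((*v) (T j i)) (y - \<omega> (take (Suc j) u))) = y"
      by (simp add: Psi_def i_def)
  qed
qed

lemma Psi_comp_similarity:
  assumes u: "u \<in> fin_words n"
  shows "surj (Psi_comp T \<omega> u)" "dist (Psi_comp T \<omega> u x) (Psi_comp T \<omega> u y) = ratio c u * dist x y"
proof -
  have eq: "ratio c u = (\<Prod>j\<leftarrow>[0..<length u]. c j (u ! j))"
    using prod.distinct_set_conv_list[of "[0..<length u]" "\<lambda>j. c j (u ! j)"]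
    by (simp add: ratio_def atLeast0LessThan)
  show "surj (Psi_comp T \<omega> u)"
    unfolding Psi_comp_def using Psi_similarity[OF u] by (intro foldr_comp_similarity(1)) auto
  show "dist (Psi_comp T \<omega> u x) (Psi_comp T \<omega> u y) = ratio c u * dist x y"
    unfolding Psi_comp_def eq using Psi_similarity[OF u] by (intro foldr_comp_similarity(2)) auto
qed

lemma JJ_eq: "u \<in> fin_words n \<Longrightarrow> JJ u = Psi_comp T \<omega> u ` J"
  using struct by (auto simp: nonautonomous_structure_def)

lemma JJ_closed: "u \<in> fin_words n \<Longrightarrow> closed (JJ u)"
  and JJ_subset: "u \<in> fin_words n \<Longrightarrow> JJ u \<subseteq> J"
  using struct unfolding nonautonomous_structure_def by blast+

lemma JJ_take_mono:
  assumes u: "u \<in> fin_words n" and "i \<le> j"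
  shows "JJ (take j u) \<subseteq> JJ (take i u)"
  using \<open>i \<le> j\<close>
proof (induction rule: dec_induct)
  case (step j)
  have "JJ (take (Suc j) u) \<subseteq> JJ (take j u)"
  proof (cases "j < length u")
    case True
    then have "take j u \<in> words n j" using take_fin_words[OF u] by simp
    then have "JJ (take j u @ [u ! j]) \<subseteq> JJ (take j u)"
      using struct nth_fin_words[OF u True] by (auto simp: nonautonomous_structure_def)
    then show ?thesis using True by (simp add: take_Suc_conv_app_nth)
  qed simp
  then show ?case using step by blast
qed simp

text \<open>Strong separation speaks of siblings only. At the first difference the two words have
  sibling prefixes, and each piece lies inside the piece of its prefix.\<close>

lemma cut_set_JJ_disjoint:
  assumes u: "u \<in> cut_set n c r" and v: "v \<in> cut_set n c r" and "u \<noteq> v"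
  shows "JJ u \<inter> JJ v = {}"
proof -
  have fu: "u \<in> fin_words n" and fv: "v \<in> fin_words n" using u v by (auto simp: cut_set_def)
  have "u \<noteq> take j v" "v \<noteq> take j u" for j
    using cut_set_prefix_free[OF u v, of j] cut_set_prefix_free[OF v u, of j] \<open>u \<noteq> v\<close> by auto
  then obtain j where j: "j < length u" "j < length v" "take j u = take j v" "u ! j \<noteq> v ! j"
    by (rule first_difference)
  have "take j u \<in> words n j" using take_fin_words[OF fu] j(1) by simp
  then have "JJ (take j u @ [u ! j]) \<inter> JJ (take j u @ [v ! j]) = {}"
    using separated nth_fin_words[OF fu j(1)] nth_fin_words[OF fv j(2)] j(4)
    unfolding strong_separation_def by blast
  then have "JJ (take (Suc j) u) \<inter> JJ (take (Suc j) v) = {}"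
    using j(3) by (simp add: take_Suc_conv_app_nth[OF j(1)] take_Suc_conv_app_nth[OF j(2)])
  moreover have "JJ u \<subseteq> JJ (take (Suc j) u)" "JJ v \<subseteq> JJ (take (Suc j) v)"
    using JJ_take_mono[OF fu, of "Suc j" "length u"] JJ_take_mono[OF fv, of "Suc j" "length v"] j(1,2)
    by simp_all
  ultimately show ?thesis by blast
qed

lemma JJ_dist_le:
  assumes "u \<in> fin_words n" "x \<in> JJ u" "y \<in> JJ u"
  shows "dist x y \<le> ratio c u * diameter J"
proof -
  obtain x' y' where "x' \<in> J" "y' \<in> J" "x = Psi_comp T \<omega> u x'" "y = Psi_comp T \<omega> u y'"
    using assms by (auto simp: JJ_eq)
  then show ?thesis
    using diameter_bounded_bound[OF compact_imp_bounded[OF J(1)]] Psi_comp_similarity(2)[OF assms(1)]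
      ratio_pos[OF assms(1)] by (simp add: mult_left_mono)
qed

text \<open>Any interior point of J serves; its image \<open>point u\<close> is the centre of a ball
  inside \<open>JJ u\<close> with radius proportional to \<open>ratio c u\<close>.\<close>

definition base :: "real^'d" where "base = (SOME x. x \<in> interior J)"

definition point :: "nat list \<Rightarrow> real^'d" where "point u = Psi_comp T \<omega> u base"

lemma base: "base \<in> interior J"
  unfolding base_def using J(2) by (auto intro!: someI_ex[of "\<lambda>x. x \<in> interior J"])

lemma point_mem: "u \<in> fin_words n \<Longrightarrow> point u \<in> JJ u"
proof -
  assume "u \<in> fin_words n"
  moreover have "base \<in> J" using base interior_subset by blast
  ultimately show "point u \<in> JJ u" by (simp add: point_def JJ_eq)
qed

lemma diameter_nonneg: "0 \<le> diameter J"
  using J(1) by (intro diameter_ge_0 compact_imp_bounded)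

text \<open>The pieces of a cut set are disjoint and each contains a ball of comparable size, so the
  points marking them are separated. Volume replaces the missing lower bound on the gaps between
  the pieces.\<close>

lemma point_separated:
  obtains \<rho> where "0 < \<rho>"
    "\<And>r u v. u \<in> cut_set n c r \<Longrightarrow> v \<in> cut_set n c r \<Longrightarrow> u \<noteq> v \<Longrightarrow> \<rho> * r \<le> dist (point u) (point v)"
proof -
  obtain \<rho> where \<rho>: "0 < \<rho>" "ball base \<rho> \<subseteq> J"
    using base mem_interior by blast
  show thesis
  proof (rule that[of "\<rho> * a"])
    fix r u v assume u: "u \<in> cut_set n c r" and v: "v \<in> cut_set n c r" and "u \<noteq> v"
    have fu: "u \<in> fin_words n" and fv: "v \<in> fin_words n" using u v by (auto simp: cut_set_def)
    have "ball (point u) (ratio c u * \<rho>) \<subseteq> Psi_comp T \<omega> u ` ball base \<rho>"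
      unfolding point_def
      by (rule similarity_image_ball[OF Psi_comp_similarity[OF fu] ratio_pos[OF fu]])
    also have "\<dots> \<subseteq> JJ u" using \<rho> JJ_eq[OF fu] by auto
    finally have "point v \<notin> ball (point u) (ratio c u * \<rho>)"
      using point_mem[OF fv] cut_set_JJ_disjoint[OF u v \<open>u \<noteq> v\<close>] by auto
    then have "ratio c u * \<rho> \<le> dist (point u) (point v)" by simp
    moreover have "a * r * \<rho> \<le> ratio c u * \<rho>"
      using cut_set_ratio(2)[OF u] \<rho>(1) by (intro mult_right_mono) auto
    ultimately show "\<rho> * a * r \<le> dist (point u) (point v)" by (simp add: mult_ac)
  qed (use \<rho> a in auto)
qed

text \<open>Counting pieces reduces to counting their marked points, which are separated by a
  multiple of r. The bound depends on L / r only, so it is uniform in r when L is a multiple of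
  r.\<close>

lemma card_cut_set_near:
  obtains \<gamma> where "0 < \<gamma>"
    "\<And>r L p U. 0 < r \<Longrightarrow> 0 \<le> L \<Longrightarrow> U \<subseteq> cut_set n c r \<Longrightarrow> point ` U \<subseteq> cball p L \<Longrightarrow>
       finite U \<and> real (card U) \<le> (2 * L / (\<gamma> * r) + 2) ^ CARD('d)"
proof -
  obtain \<rho> where \<rho>: "0 < \<rho>" "\<And>r u v. u \<in> cut_set n c r \<Longrightarrow> v \<in> cut_set n c r \<Longrightarrow> u \<noteq> v \<Longrightarrow>
      \<rho> * r \<le> dist (point u) (point v)"
    using point_separated by blast
  show thesis
  \<comment> \<open>The packing bound asks for separation \<open>CARD('d)\<close> times the side of
    the cubes, hence the divisor.\<close>
  proof (rule that[of "\<rho> / real CARD('d)"])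
    fix r L :: real and p U
    assume r: "0 < r" and L: "0 \<le> L" and U: "U \<subseteq> cut_set n c r" "point ` U \<subseteq> cball p L"
    have sep: "\<rho> * r \<le> dist (point u) (point v)" if "u \<in> U" "v \<in> U" "u \<noteq> v" for u v
      using \<rho>(2) U(1) that by blast
    have inj: "inj_on point U"
    proof (rule inj_onI, rule ccontr)
      fix u v assume "u \<in> U" "v \<in> U" "point u = point v" "u \<noteq> v"
      with sep[of u v] mult_pos_pos[OF \<rho>(1) r] show False by simp
    qed
    have sep': "real CARD('d) * (\<rho> / real CARD('d) * r) \<le> dist x y"
      if "x \<in> point ` U" "y \<in> point ` U" "x \<noteq> y" for x y
    proof -
      from that(1) obtain u where u: "x = point u" "u \<in> U" by (rule imageE)
      from that(2) obtain v where v: "y = point v" "v \<in> U" by (rule imageE)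
      have "u \<noteq> v" using that(3) u v by metis
      with sep[OF u(2) v(2)] show ?thesis by (simp add: u v)
    qed
    have "0 < \<rho> / real CARD('d) * r" using \<rho>(1) r by (intro mult_pos_pos divide_pos_pos) simp_all
    from card_separated_points[OF U(2) this L sep']
    have "finite (point ` U)" "real (card (point ` U)) \<le> (2 * L / (\<rho> / real CARD('d) * r) + 2) ^ CARD('d)"
      by blast+
    then show "finite U \<and> real (card U) \<le> (2 * L / (\<rho> / real CARD('d) * r) + 2) ^ CARD('d)"
      using inj by (auto dest: finite_imageD simp: card_image)
  qed (use \<rho> in auto)
qed

lemma card_cut_set:
  obtains C where "0 < C"
    "\<And>r. 0 < r \<Longrightarrow> r < 1 \<Longrightarrow> finite (cut_set n c r) \<and> real (card (cut_set n c r)) \<le> (C / r) ^ CARD('d)"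
proof -
  obtain \<gamma> where \<gamma>: "0 < \<gamma>"
    "\<And>r L p U. 0 < r \<Longrightarrow> 0 \<le> L \<Longrightarrow> U \<subseteq> cut_set n c r \<Longrightarrow> point ` U \<subseteq> cball p L \<Longrightarrow>
       finite U \<and> real (card U) \<le> (2 * L / (\<gamma> * r) + 2) ^ CARD('d)"
    using card_cut_set_near by blast
  show thesis
  proof (rule that[of "2 * diameter J / \<gamma> + 2"])
    fix r :: real assume r: "0 < r" "r < 1"
    have "point u \<in> J" if "u \<in> cut_set n c r" for u
      using that point_mem JJ_subset by (auto simp: cut_set_def)
    then have "point ` cut_set n c r \<subseteq> cball base (diameter J)"
      using diameter_bounded_bound[OF compact_imp_bounded[OF J(1)]] base interior_subset[of J] by auto
    then have *: "finite (cut_set n c r)"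
      "real (card (cut_set n c r)) \<le> (2 * diameter J / (\<gamma> * r) + 2) ^ CARD('d)"
      using \<gamma>(2)[OF r(1) diameter_nonneg order_refl] by auto
    have "2 * diameter J / (\<gamma> * r) + 2 \<le> (2 * diameter J / \<gamma> + 2) / r"
      using r \<gamma>(1) by (simp add: field_simps)
    then have "(2 * diameter J / (\<gamma> * r) + 2) ^ CARD('d) \<le> ((2 * diameter J / \<gamma> + 2) / r) ^ CARD('d)"
      using r \<gamma>(1) diameter_nonneg by (intro power_mono) (auto intro!: add_nonneg_nonneg)
    with * show "finite (cut_set n c r) \<and>
        real (card (cut_set n c r)) \<le> ((2 * diameter J / \<gamma> + 2) / r) ^ CARD('d)"
      by linarith
  qed (use \<gamma> diameter_nonneg in \<open>auto intro: add_nonneg_pos\<close>)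
qed

lemma cut_set_JJ_dist_le:
  assumes "u \<in> cut_set n c r" "x \<in> JJ u" "y \<in> JJ u"
  shows "dist x y \<le> diameter J * r"
proof -
  have "dist x y \<le> ratio c u * diameter J" using assms JJ_dist_le by (auto simp: cut_set_def)
  also have "\<dots> \<le> r * diameter J"
    using cut_set_ratio(1)[OF assms(1)] diameter_nonneg by (rule mult_right_mono)
  finally show ?thesis by (simp add: mult.commute)
qed

text \<open>Diameters of pieces and cubes and the separation of marked points are all controlled in
  units of r, so r cancels from both counts.\<close>

lemma cut_set_mesh_cubes_multiplicity:
  obtains K where "1 \<le> K"
    "\<And>r Q. 0 < r \<Longrightarrow> Q \<in> mesh_cubes r \<Longrightarrow> real (card {u \<in> cut_set n c r. JJ u \<inter> Q \<noteq> {}}) \<le> K"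
    "\<And>r u. 0 < r \<Longrightarrow> u \<in> cut_set n c r \<Longrightarrow>
       finite {Q \<in> mesh_cubes r. JJ u \<inter> Q \<noteq> {}} \<and> real (card {Q \<in> mesh_cubes r. JJ u \<inter> Q \<noteq> {}}) \<le> K"
proof -
  obtain \<gamma> where \<gamma>: "0 < \<gamma>"
    "\<And>r L p U. 0 < r \<Longrightarrow> 0 \<le> L \<Longrightarrow> U \<subseteq> cut_set n c r \<Longrightarrow> point ` U \<subseteq> cball p L \<Longrightarrow>
       finite U \<and> real (card U) \<le> (2 * L / (\<gamma> * r) + 2) ^ CARD('d)"
    using card_cut_set_near by blast
  \<comment> \<open>In units of r, a bound for the distance from a marked point to any point of a
    cube that its piece meets: diameter of the piece plus diameter of the cube.\<close>
  define D where "D = diameter J + real CARD('d)"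
  have D: "0 \<le> D" using diameter_nonneg by (simp add: D_def)
  define K1 where "K1 = (2 * D / \<gamma> + 2) ^ CARD('d)"
  define K2 where "K2 = (2 * diameter J + 2) ^ CARD('d)"
  show thesis
  proof (rule that[of "max 1 (max K1 K2)"])
    fix r :: real and Q :: "(real^'d) set" assume r: "0 < r" and Q: "Q \<in> mesh_cubes r"
    define U where "U = {u \<in> cut_set n c r. JJ u \<inter> Q \<noteq> {}}"
    have "real (card U) \<le> K1"
    proof (cases "U = {}")
      case True
      then show ?thesis using D \<gamma>(1) by (simp add: K1_def)
    next
      case False
      then obtain p where p: "p \<in> Q" by (auto simp: U_def)
      have "point ` U \<subseteq> cball p (D * r)"
      proof safe
        fix u assume "u \<in> U"
        then obtain x where u: "u \<in> cut_set n c r" and x: "x \<in> JJ u" "x \<in> Q" by (auto simp: U_def)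
        have "dist (point u) x \<le> diameter J * r"
          using cut_set_JJ_dist_le[OF u point_mem x(1)] u by (auto simp: cut_set_def)
        moreover have "dist x p \<le> real CARD('d) * r" using mesh_cube_dist_le Q x p by blast
        ultimately show "point u \<in> cball p (D * r)"
          using dist_triangle[of "point u" p x] by (simp add: D_def dist_commute algebra_simps)
      qed
      then have "real (card U) \<le> (2 * (D * r) / (\<gamma> * r) + 2) ^ CARD('d)"
        using \<gamma>(2)[of r "D * r" U p] r D by (auto simp: U_def)
      also have "\<dots> = K1" using r by (simp add: K1_def)
      finally show ?thesis .
    qed
    then show "real (card {u \<in> cut_set n c r. JJ u \<inter> Q \<noteq> {}}) \<le> max 1 (max K1 K2)"
      by (simp add: U_def)
  next
    fix r :: real and u assume r: "0 < r" and u: "u \<in> cut_set n c r"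
    have "JJ u \<subseteq> cball (point u) (diameter J * r)"
      using cut_set_JJ_dist_le[OF u point_mem] u by (auto simp: cut_set_def)
    from card_mesh_cubes_meeting[OF this r]
    have "finite {Q \<in> mesh_cubes r. JJ u \<inter> Q \<noteq> {}}"
      "real (card {Q \<in> mesh_cubes r. JJ u \<inter> Q \<noteq> {}}) \<le> (2 * (diameter J * r) / r + 2) ^ CARD('d)"
      using r diameter_nonneg by auto
    moreover have "(2 * (diameter J * r) / r + 2) ^ CARD('d) = K2"
      using r by (simp add: K2_def)
    ultimately show "finite {Q \<in> mesh_cubes r. JJ u \<inter> Q \<noteq> {}} \<and>
        real (card {Q \<in> mesh_cubes r. JJ u \<inter> Q \<noteq> {}}) \<le> max 1 (max K1 K2)"
      by linarith
  qed simp
qed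

end

section \<open>The projected measure\<close>

context separated_similar_set
begin

lemma prefix_JJ_dist_le:
  assumes w: "w \<in> inf_words n" and "x \<in> JJ (prefix_word w k)" "y \<in> JJ (prefix_word w k)"
  shows "dist x y \<le> b ^ k * diameter J"
proof -
  have u: "prefix_word w k \<in> fin_words n" using w by (rule prefix_mem_fin_words)
  have "dist x y \<le> ratio c (prefix_word w k) * diameter J" using u assms(2,3) by (rule JJ_dist_le)
  also have "\<dots> \<le> b ^ k * diameter J"
    using ratio_le_power[OF u] diameter_nonneg by (intro mult_right_mono) auto
  finally show ?thesis .
qed

lemma power_diameter_tendsto: "(\<lambda>k. b ^ k * diameter J) \<longlonglongrightarrow> 0"
  using b by (intro tendsto_mult_left_zero LIMSEQ_realpow_zero) auto

text \<open>Nested nonempty compact sets have a common point, unique because the diameters are at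
  most b ^ k times that of J; so the definite description denotes.\<close>

lemma word_projection_mem:
  assumes w: "w \<in> inf_words n"
  shows "word_projection JJ w \<in> JJ (prefix_word w k)"
proof -
  define F where "F k = JJ (prefix_word w k)" for k
  have u: "prefix_word w k \<in> fin_words n" for k using w by (rule prefix_mem_fin_words)
  have "F k \<subseteq> F j" if "j \<le> k" for j k
    using JJ_take_mono[OF u that, of k] that by (simp add: F_def take_prefix_word)
  moreover have "compact (F k)" for k
    unfolding F_def using compact_Int_closed[OF J(1) JJ_closed[OF u]] JJ_subset[OF u]
    by (simp add: Int_absorb1)
  moreover have "F k \<noteq> {}" for k using point_mem[OF u] by (auto simp: F_def)
  ultimately have "\<Inter>(range F) \<noteq> {}" by (intro compact_nest)
  then obtain x where x: "x \<in> (\<Inter>k. F k)" by blast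
  have "y = x" if y: "y \<in> (\<Inter>k. F k)" for y
  proof -
    have "dist y x \<le> b ^ k * diameter J" for k
      using prefix_JJ_dist_le[OF w, of y k x] x y by (auto simp: F_def)
    then have "dist y x \<le> 0"
      using power_diameter_tendsto by (intro LIMSEQ_le_const) auto
    then show ?thesis by simp
  qed
  then have "word_projection JJ w \<in> (\<Inter>k. F k)"
    unfolding word_projection_def F_def[symmetric] using x by (rule theI[rotated])
  then show ?thesis by (simp add: F_def)
qed

text \<open>Exhibits the projection as a limit of functions of finitely many letters, from which its
  measurability is obtained.\<close>

lemma point_prefix_tendsto:
  assumes w: "w \<in> inf_words n"
  shows "(\<lambda>k. point (prefix_word w k)) \<longlonglongrightarrow> word_projection JJ w"
proof (rule iffD2[OF tendsto_dist_iff], rule tendsto_sandwich[OF _ _ tendsto_const power_diameter_tendsto])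
  show "\<forall>\<^sub>F k in sequentially. dist (point (prefix_word w k)) (word_projection JJ w) \<le> b ^ k * diameter J"
    using prefix_JJ_dist_le[OF w point_mem[OF prefix_mem_fin_words[OF w]] word_projection_mem[OF w]]
    by simp
qed simp

lemma cylinder_projection:
  "w \<in> cylinder n u \<Longrightarrow> word_projection JJ w \<in> JJ u"
  using word_projection_mem[of w "length u"] by (simp add: cylinder_def)

end

text \<open>There are countably many finite words, so singletons suffice; the preimage of one is
  empty or fixes finitely many coordinates, and is closed in the product topology.\<close>

lemma prefix_word_measurable: "(\<lambda>w. prefix_word w k) \<in> borel \<rightarrow>\<^sub>M count_space UNIV"
  unfolding measurable_count_space_eq2_countable
proof (intro conjI ballI)
  fix u :: "nat list"
  have "closed ((\<lambda>w. prefix_word w k) -` {u})"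
  proof (cases "length u = k")
    case True
    then have "(\<lambda>w. prefix_word w k) -` {u} = (\<Inter>j\<in>{..<k}. {w. w j = u ! j})"
      by (simp add: set_eq_iff prefix_word_def list_eq_iff_nth_eq) auto
    moreover have "closed {w :: nat \<Rightarrow> nat. w j = u ! j}" for j
      by (intro closed_Collect_eq continuous_on_const continuous_on_product_coordinates)
    ultimately show ?thesis by (simp add: closed_INT)
  next
    case False
    then have "(\<lambda>w. prefix_word w k) -` {u} = {}" by auto
    then show ?thesis by simp
  qed
  then show "(\<lambda>w. prefix_word w k) -` {u} \<inter> space borel \<in> sets borel"
    by simp
qed auto

locale separated_similar_measure = separated_similar_set n c a b T \<omega> J JJ
  for n c a b and T :: "nat \<Rightarrow> nat \<Rightarrow> real^'d^'d" and \<omega> J JJ +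
  fixes \<mu> :: "(nat \<Rightarrow> nat) measure"
  assumes \<mu>: "positive_finite_borel_measure_on_words n \<mu>"
begin

sublocale finite_measure \<mu>
  using \<mu> by (simp add: positive_finite_borel_measure_on_words_def)

lemma sets_\<mu>: "sets \<mu> = sets (restrict_space borel (inf_words n))"
  using \<mu> by (simp add: positive_finite_borel_measure_on_words_def)

lemma space_\<mu>: "space \<mu> = inf_words n"
  using sets_eq_imp_space_eq[OF sets_\<mu>] by (simp add: space_restrict_space)

lemma total_pos: "0 < measure \<mu> (inf_words n)"
  using \<mu> by (simp add: positive_finite_borel_measure_on_words_def emeasure_eq_measure space_\<mu>)

lemma prefix_word_measurable': "(\<lambda>w. prefix_word w k) \<in> \<mu> \<rightarrow>\<^sub>M count_space UNIV"
  using measurable_restrict_space1[OF prefix_word_measurable] measurable_cong_sets[OF sets_\<mu> refl]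
  by blast

lemma cylinder_sets: "cylinder n u \<in> sets \<mu>"
proof -
  have "cylinder n u = (\<lambda>w. prefix_word w (length u)) -` {u} \<inter> space \<mu>"
    by (auto simp: cylinder_def space_\<mu>)
  then show ?thesis using measurable_sets[OF prefix_word_measurable'] by simp
qed

lemma word_projection_measurable: "word_projection JJ \<in> borel_measurable \<mu>"
proof (rule borel_measurable_LIMSEQ_metric)
  fix k
  have "point \<in> count_space UNIV \<rightarrow>\<^sub>M borel" by simp
  then show "(\<lambda>w. point (prefix_word w k)) \<in> borel_measurable \<mu>"
    using prefix_word_measurable' by (rule measurable_compose[rotated])
next
  fix w assume "w \<in> space \<mu>"
  then show "(\<lambda>k. point (prefix_word w k)) \<longlonglongrightarrow> word_projection JJ w"
    by (intro point_prefix_tendsto) (simp add: space_\<mu>)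
qed

text \<open>The matrix cells: for fixed u they split the cylinder by cubes, for fixed Q they split
  the preimage of the cube by cylinders.\<close>

definition piece :: "nat list \<Rightarrow> (real^'d) set \<Rightarrow> (nat \<Rightarrow> nat) set" where
  "piece u Q = cylinder n u \<inter> word_projection JJ -` Q"

text \<open>Selecting cubes by the pieces they meet keeps the family finite while every cube outside
  it has mass 0.\<close>

definition cubes :: "real \<Rightarrow> (real^'d) set set" where
  "cubes r = (\<Union>u\<in>cut_set n c r. {Q \<in> mesh_cubes r. JJ u \<inter> Q \<noteq> {}})"

lemma piece_sets: "Q \<in> mesh_cubes r \<Longrightarrow> piece u Q \<in> sets \<mu>"
proof -
  assume "Q \<in> mesh_cubes r"
  then have "word_projection JJ -` Q \<inter> space \<mu> \<in> sets \<mu>"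
    by (intro measurable_sets[OF word_projection_measurable] mesh_cubes_borel)
  moreover have "piece u Q = cylinder n u \<inter> (word_projection JJ -` Q \<inter> space \<mu>)"
    by (auto simp: piece_def cylinder_def space_\<mu>)
  ultimately show ?thesis using cylinder_sets by auto
qed

lemma piece_empty: "JJ u \<inter> Q = {} \<Longrightarrow> piece u Q = {}"
  using cylinder_projection by (auto simp: piece_def)

lemma finite_cut_set:
  assumes "0 < r" "r < 1"
  shows "finite (cut_set n c r)"
proof -
  obtain C where "\<And>r. 0 < r \<Longrightarrow> r < 1 \<Longrightarrow>
      finite (cut_set n c r) \<and> real (card (cut_set n c r)) \<le> (C / r) ^ CARD('d)"
    using card_cut_set by blast
  from this[OF assms] show ?thesis by blast
qed

lemma finite_cubes: "0 < r \<Longrightarrow> finite (cubes r)"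
proof -
  assume r: "0 < r"
  have "J \<subseteq> cball base (diameter J)"
    using diameter_bounded_bound[OF compact_imp_bounded[OF J(1)]] base interior_subset[of J] by auto
  from card_mesh_cubes_meeting(1)[OF this r diameter_nonneg]
  show "finite (cubes r)"
  proof (rule finite_subset[rotated])
    show "cubes r \<subseteq> {Q \<in> mesh_cubes r. J \<inter> Q \<noteq> {}}"
      using JJ_subset unfolding cubes_def cut_set_def by blast
  qed
qed

section \<open>Masses of cylinders and cubes as row and column sums\<close>

lemma measure_cylinder_eq_sum:
  assumes r: "0 < r" "r < 1" and u: "u \<in> cut_set n c r"
  shows "measure \<mu> (cylinder n u) = (\<Sum>Q\<in>cubes r. measure \<mu> (piece u Q))"
proof -
  have "cylinder n u = (\<Union>Q\<in>cubes r. piece u Q)"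
  proof safe
    fix w assume w: "w \<in> cylinder n u"
    obtain Q where Q: "Q \<in> mesh_cubes r" "word_projection JJ w \<in> Q"
      using mesh_cubes_cover[OF r(1)] by blast
    then have "Q \<in> cubes r" using u cylinder_projection[OF w] by (auto simp: cubes_def)
    then show "w \<in> (\<Union>Q\<in>cubes r. piece u Q)" using w Q by (auto simp: piece_def)
  qed (auto simp: piece_def)
  also have "measure \<mu> \<dots> = (\<Sum>Q\<in>cubes r. measure \<mu> (piece u Q))"
  proof (rule finite_measure_finite_Union)
    show "disjoint_family_on (piece u) (cubes r)"
      using mesh_cubes_disjoint[OF r(1)] unfolding disjoint_family_on_def piece_def cubes_def by blast
    show "piece u ` cubes r \<subseteq> sets \<mu>" using piece_sets by (auto simp: cubes_def)
  qed (rule finite_cubes[OF r(1)])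
  finally show ?thesis .
qed

lemma measure_cube_eq_sum:
  assumes r: "0 < r" "r < 1" and Q: "Q \<in> mesh_cubes r"
  shows "measure (image_measure JJ \<mu>) Q = (\<Sum>u\<in>cut_set n c r. measure \<mu> (piece u Q))"
proof -
  have "measure (image_measure JJ \<mu>) Q = measure \<mu> (word_projection JJ -` Q \<inter> space \<mu>)"
    unfolding image_measure_def
    by (intro measure_distr word_projection_measurable) (use mesh_cubes_borel[OF Q] in simp)
  also have "word_projection JJ -` Q \<inter> space \<mu> = (\<Union>u\<in>cut_set n c r. piece u Q)"
  proof safe
    fix w assume w: "word_projection JJ w \<in> Q" "w \<in> space \<mu>"
    then obtain u where "u \<in> cut_set n c r" "w \<in> cylinder n u"
      using cut_set_cylinder_cover[OF r] unfolding space_\<mu> by blast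
    then show "w \<in> (\<Union>u\<in>cut_set n c r. piece u Q)" using w by (auto simp: piece_def)
  qed (auto simp: piece_def cylinder_def space_\<mu>)
  also have "measure \<mu> \<dots> = (\<Sum>u\<in>cut_set n c r. measure \<mu> (piece u Q))"
  proof (rule finite_measure_finite_Union)
    show "disjoint_family_on (\<lambda>u. piece u Q) (cut_set n c r)"
      using cut_set_cylinder_unique unfolding disjoint_family_on_def piece_def by blast
  qed (use finite_cut_set[OF r] piece_sets[OF Q] in auto)
  finally show ?thesis .
qed

lemma sum_measure_cylinder:
  assumes r: "0 < r" "r < 1"
  shows "(\<Sum>u\<in>cut_set n c r. measure \<mu> (cylinder n u)) = measure \<mu> (inf_words n)"
proof -
  have "inf_words n = (\<Union>u\<in>cut_set n c r. cylinder n u)"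
  proof safe
    fix w assume "w \<in> inf_words n"
    then obtain u where "u \<in> cut_set n c r" "w \<in> cylinder n u"
      by (rule cut_set_cylinder_cover[OF r])
    then show "w \<in> (\<Union>u\<in>cut_set n c r. cylinder n u)" by blast
  qed (simp add: cylinder_def)
  then have "measure \<mu> (inf_words n) = measure \<mu> (\<Union>u\<in>cut_set n c r. cylinder n u)" by simp
  also have "\<dots> = (\<Sum>u\<in>cut_set n c r. measure \<mu> (cylinder n u))"
  proof (rule finite_measure_finite_Union)
    show "disjoint_family_on (cylinder n) (cut_set n c r)"
      using cut_set_cylinder_unique unfolding disjoint_family_on_def by blast
  qed (use finite_cut_set[OF r] cylinder_sets in auto)
  finally show ?thesis by simp
qed

text \<open>The N of the overview; neither the translations nor the set J enter it.\<close>

definition word_log_sum :: "real \<Rightarrow> real \<Rightarrow> real" where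
  "word_log_sum q r = log_sum q (\<Sum>u\<in>cut_set n c r. pterm q (measure \<mu> (cylinder n u)))"

definition cube_log_sum :: "real \<Rightarrow> real \<Rightarrow> real" where
  "cube_log_sum q r = log_sum q (\<Sum>Q\<in>cubes r. pterm q (measure (image_measure JJ \<mu>) Q))"

lemma sum_measure_cubes:
  assumes r: "0 < r" "r < 1"
  shows "(\<Sum>Q\<in>cubes r. measure (image_measure JJ \<mu>) Q) = measure \<mu> (inf_words n)"
proof -
  have "(\<Sum>Q\<in>cubes r. measure (image_measure JJ \<mu>) Q)
      = (\<Sum>Q\<in>cubes r. \<Sum>u\<in>cut_set n c r. measure \<mu> (piece u Q))"
    by (rule sum.cong) (auto simp: cubes_def measure_cube_eq_sum[OF r])
  also have "\<dots> = (\<Sum>u\<in>cut_set n c r. \<Sum>Q\<in>cubes r. measure \<mu> (piece u Q))" by (rule sum.swap)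
  also have "\<dots> = measure \<mu> (inf_words n)"
    unfolding sum_measure_cylinder[OF r, symmetric]
    by (rule sum.cong) (auto simp: measure_cylinder_eq_sum[OF r])
  finally show ?thesis .
qed

text \<open>Cubes outside the finite family have mass 0 and every summand vanishes at 0, so the
  infinite sum collapses to a finite one.\<close>

lemma dim_quotient_eq:
  assumes r: "0 < r" "r < 1" and q: "0 < q"
  shows "dim_quotient q (image_measure JJ \<mu>) r = ereal (cube_log_sum q r / ln r)"
proof -
  let ?\<nu> = "image_measure JJ \<mu>"
  have 0: "measure ?\<nu> Q = 0" if "Q \<in> mesh_cubes r - cubes r" for Q
  proof -
    have "piece u Q = {}" if "u \<in> cut_set n c r" for u
    proof (rule piece_empty)
      show "JJ u \<inter> Q = {}" using that \<open>Q \<in> mesh_cubes r - cubes r\<close> unfolding cubes_def by blast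
    qed
    then show ?thesis using measure_cube_eq_sum[OF r, of Q] \<open>Q \<in> mesh_cubes r - cubes r\<close> by simp
  qed
  have sum: "(\<Sum>\<^sub>\<infinity>Q\<in>mesh_cubes r. ereal (f (measure ?\<nu> Q))) = ereal (\<Sum>Q\<in>cubes r. f (measure ?\<nu> Q))"
    if "f 0 = 0" for f :: "real \<Rightarrow> real"
  proof -
    have "(\<Sum>\<^sub>\<infinity>Q\<in>mesh_cubes r. ereal (f (measure ?\<nu> Q))) = (\<Sum>\<^sub>\<infinity>Q\<in>cubes r. ereal (f (measure ?\<nu> Q)))"
      using 0 that by (intro infsum_cong_neutral) (auto simp: cubes_def)
    then show ?thesis using finite_cubes[OF r(1)] by simp
  qed
  show ?thesis
  proof (cases "q = 1")
    case True
    then show ?thesis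
      using sum[of "\<lambda>x. x * ln x"] r
      by (simp add: dim_quotient_def cube_log_sum_def log_sum_def pterm_def)
  next
    case False
    \<comment> \<open>Positivity keeps \<open>ereal_log\<close> away from its value -\<infinity> at
      0.\<close>
    have "0 < (\<Sum>Q\<in>cubes r. measure ?\<nu> Q powr q)"
      using total_pos sum_measure_cubes[OF r] by (intro sum_powr_pos finite_cubes[OF r(1)]) auto
    then show ?thesis
      using False sum[of "\<lambda>x. x powr q"] r
      by (simp add: dim_quotient_def cube_log_sum_def log_sum_def pterm_def ereal_log_def)
  qed
qed

lemma cube_word_log_sum:
  assumes q: "0 < q" "q = 1 \<longrightarrow> measure \<mu> (space \<mu>) = 1"
  obtains C where "\<And>r. 0 < r \<Longrightarrow> r < 1 \<Longrightarrow> \<bar>word_log_sum q r - cube_log_sum q r\<bar> \<le> C"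
proof -
  obtain K where K: "1 \<le> K"
    "\<And>r Q. 0 < r \<Longrightarrow> Q \<in> mesh_cubes r \<Longrightarrow> real (card {u \<in> cut_set n c r. JJ u \<inter> Q \<noteq> {}}) \<le> K"
    "\<And>r u. 0 < r \<Longrightarrow> u \<in> cut_set n c r \<Longrightarrow>
       finite {Q \<in> mesh_cubes r. JJ u \<inter> Q \<noteq> {}} \<and> real (card {Q \<in> mesh_cubes r. JJ u \<inter> Q \<noteq> {}}) \<le> K"
    by (rule cut_set_mesh_cubes_multiplicity) blast
  show thesis
  proof (rule that[of "ln K"])
    fix r :: real assume r: "0 < r" "r < 1"
    have total: "(\<Sum>u\<in>cut_set n c r. \<Sum>Q\<in>cubes r. measure \<mu> (piece u Q)) = measure \<mu> (inf_words n)"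
      unfolding sum_measure_cylinder[OF r, symmetric]
      by (rule sum.cong) (auto simp: measure_cylinder_eq_sum[OF r])
    \<comment> \<open>A cell carries mass only if the piece meets the cube, so the multiplicity
      bounds count the nonzero entries of rows and columns.\<close>
    have nz: "JJ u \<inter> Q \<noteq> {}" if "measure \<mu> (piece u Q) \<noteq> 0" for u Q
      using that piece_empty[of u Q] by auto
    have "\<bar>log_sum q (\<Sum>u\<in>cut_set n c r. pterm q (\<Sum>Q\<in>cubes r. measure \<mu> (piece u Q)))
        - log_sum q (\<Sum>Q\<in>cubes r. pterm q (\<Sum>u\<in>cut_set n c r. measure \<mu> (piece u Q)))\<bar> \<le> ln K"
    proof (rule log_sum_rows_columns)
      fix u assume u: "u \<in> cut_set n c r"
      have "card {Q \<in> cubes r. measure \<mu> (piece u Q) \<noteq> 0} \<le> card {Q \<in> mesh_cubes r. JJ u \<inter> Q \<noteq> {}}"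
        using K(3)[OF r(1) u] nz by (intro card_mono) (auto simp: cubes_def)
      then show "real (card {Q \<in> cubes r. measure \<mu> (piece u Q) \<noteq> 0}) \<le> K"
        using K(3)[OF r(1) u] by linarith
    next
      fix Q assume "Q \<in> cubes r"
      then have Q: "Q \<in> mesh_cubes r" by (auto simp: cubes_def)
      have "card {u \<in> cut_set n c r. measure \<mu> (piece u Q) \<noteq> 0} \<le> card {u \<in> cut_set n c r. JJ u \<inter> Q \<noteq> {}}"
        using finite_cut_set[OF r] nz by (intro card_mono) auto
      then show "real (card {u \<in> cut_set n c r. measure \<mu> (piece u Q) \<noteq> 0}) \<le> K"
        using K(2)[OF r(1) Q] by linarith
    qed (use r q K(1) total total_pos space_\<mu> finite_cubes finite_cut_set in auto)
    moreover have "(\<Sum>u\<in>cut_set n c r. pterm q (\<Sum>Q\<in>cubes r. measure \<mu> (piece u Q)))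
        = (\<Sum>u\<in>cut_set n c r. pterm q (measure \<mu> (cylinder n u)))"
      by (rule sum.cong) (auto simp: measure_cylinder_eq_sum[OF r])
    moreover have "(\<Sum>Q\<in>cubes r. pterm q (\<Sum>u\<in>cut_set n c r. measure \<mu> (piece u Q)))
        = (\<Sum>Q\<in>cubes r. pterm q (measure (image_measure JJ \<mu>) Q))"
      by (rule sum.cong) (auto simp: cubes_def measure_cube_eq_sum[OF r])
    ultimately show "\<bar>word_log_sum q r - cube_log_sum q r\<bar> \<le> ln K"
      by (simp add: word_log_sum_def cube_log_sum_def)
  qed
qed

end

section \<open>The dimensions of the projected measure\<close>

text \<open>The new bound may depend on B but not on r, so the same scales serve, whether these are
  all small r or only recurring ones.\<close>

lemma eventually_bounded_transfer:
  fixes X Y :: "real \<Rightarrow> real"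
  assumes "\<And>B. \<exists>B'. \<forall>r. 0 < r \<longrightarrow> r < 1 \<longrightarrow> X r \<le> B \<longrightarrow> Y r \<le> B'"
  shows "(\<exists>B. \<forall>\<^sub>F r in at_right 0. X r \<le> B) \<Longrightarrow> (\<exists>B. \<forall>\<^sub>F r in at_right 0. Y r \<le> B)"
    and "(\<exists>B. \<exists>\<^sub>F r in at_right 0. X r \<le> B) \<Longrightarrow> (\<exists>B. \<exists>\<^sub>F r in at_right 0. Y r \<le> B)"
proof -
  assume "\<exists>B. \<forall>\<^sub>F r in at_right 0. X r \<le> B"
  then obtain B where B: "\<forall>\<^sub>F r in at_right 0. X r \<le> B" by blast
  obtain B' where "\<forall>r. 0 < r \<longrightarrow> r < 1 \<longrightarrow> X r \<le> B \<longrightarrow> Y r \<le> B'" using assms by blast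
  then have "\<forall>\<^sub>F r in at_right 0. Y r \<le> B'"
    using B eventually_unit_interval by (auto elim: eventually_elim2)
  then show "\<exists>B. \<forall>\<^sub>F r in at_right 0. Y r \<le> B" by blast
next
  assume "\<exists>B. \<exists>\<^sub>F r in at_right 0. X r \<le> B"
  then obtain B where B: "\<exists>\<^sub>F r in at_right 0. X r \<le> B" by blast
  obtain B' where B': "\<forall>r. 0 < r \<longrightarrow> r < 1 \<longrightarrow> X r \<le> B \<longrightarrow> Y r \<le> B'" using assms by blast
  have "\<forall>\<^sub>F r in at_right 0. X r \<le> B \<longrightarrow> Y r \<le> B'"
    using eventually_unit_interval by eventually_elim (use B' in auto)
  then have "\<exists>\<^sub>F r in at_right 0. Y r \<le> B'" using B by (rule frequently_rev_mp[rotated])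
  then show "\<exists>B. \<exists>\<^sub>F r in at_right 0. Y r \<le> B" by blast
qed

lemma eventually_bounded_iff:
  fixes X Y :: "real \<Rightarrow> real"
  assumes "\<And>B. \<exists>B'. \<forall>r. 0 < r \<longrightarrow> r < 1 \<longrightarrow> X r \<le> B \<longrightarrow> Y r \<le> B'"
    and "\<And>B. \<exists>B'. \<forall>r. 0 < r \<longrightarrow> r < 1 \<longrightarrow> Y r \<le> B \<longrightarrow> X r \<le> B'"
  shows "(\<exists>B. \<forall>\<^sub>F r in at_right 0. X r \<le> B) \<longleftrightarrow> (\<exists>B. \<forall>\<^sub>F r in at_right 0. Y r \<le> B)"
    and "(\<exists>B. \<exists>\<^sub>F r in at_right 0. X r \<le> B) \<longleftrightarrow> (\<exists>B. \<exists>\<^sub>F r in at_right 0. Y r \<le> B)"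
  using eventually_bounded_transfer[of X Y] eventually_bounded_transfer[of Y X] assms
  by blast+

context separated_similar_measure
begin

lemma word_log_sum_bounds:
  assumes q: "0 < q" "q = 1 \<longrightarrow> measure \<mu> (space \<mu>) = 1"
  obtains B where "\<And>r. 0 < r \<Longrightarrow> r < 1 \<Longrightarrow> word_log_sum q r \<le> B"
    "\<And>r. 0 < r \<Longrightarrow> r < 1 \<Longrightarrow> real CARD('d) * ln r - B \<le> word_log_sum q r"
proof -
  obtain C where C: "0 < C" "\<And>r. 0 < r \<Longrightarrow> r < 1 \<Longrightarrow>
      finite (cut_set n c r) \<and> real (card (cut_set n c r)) \<le> (C / r) ^ CARD('d)"
    by (rule card_cut_set) blast
  \<comment> \<open>For q = 1 this is 0 by division by zero, in agreement with ln 1 = 0.\<close>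
  define M where "M = q * ln (measure \<mu> (inf_words n)) / (q - 1)"
  have bd: "word_log_sum q r \<le> M" "M - real CARD('d) * (ln C - ln r) \<le> word_log_sum q r"
    if r: "0 < r" "r < 1" for r
  proof -
    have "ln ((C / r) ^ CARD('d)) = real CARD('d) * (ln C - ln r)"
      using C(1) r by (simp add: ln_realpow ln_div)
    moreover have "real (card (cut_set n c r)) \<le> (C / r) ^ CARD('d)" using C(2)[OF r] by blast
    ultimately show "word_log_sum q r \<le> M" "M - real CARD('d) * (ln C - ln r) \<le> word_log_sum q r"
      using log_sum_bounds[OF finite_cut_set[OF r], of "\<lambda>u. measure \<mu> (cylinder n u)" "(C / r) ^ CARD('d)" q]
        total_pos q by (simp_all add: sum_measure_cylinder[OF r] word_log_sum_def M_def space_\<mu>)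
  qed
  show thesis
  proof (rule that[of "\<bar>M\<bar> + real CARD('d) * \<bar>ln C\<bar>"])
    fix r :: real assume r: "0 < r" "r < 1"
    show "word_log_sum q r \<le> \<bar>M\<bar> + real CARD('d) * \<bar>ln C\<bar>"
      using bd(1)[OF r] by (smt (verit) mult_nonneg_nonneg of_nat_0_le_iff abs_ge_zero)
    have "real CARD('d) * ln C \<le> real CARD('d) * \<bar>ln C\<bar>" by (intro mult_left_mono) auto
    then show "real CARD('d) * ln r - (\<bar>M\<bar> + real CARD('d) * \<bar>ln C\<bar>) \<le> word_log_sum q r"
      using bd(2)[OF r] unfolding right_diff_distrib by linarith
  qed
qed

text \<open>The masses are weights of sum 1, so the extra term is an average of
  \<open>- s * ln (ratio c u)\<close>, and on the cut set \<open>ln (ratio c u)\<close> lies between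
  ln a + ln r and ln r.\<close>

lemma F_sum_eq_1_bounds:
  assumes r: "0 < r" "r < 1" and s: "0 < s" and M: "measure \<mu> (space \<mu>) = 1"
  shows "word_log_sum 1 r - s * ln r \<le> F_sum n c \<mu> 1 s r"
    and "F_sum n c \<mu> 1 s r \<le> word_log_sum 1 r - s * ln r - s * ln a"
proof -
  let ?m = "\<lambda>u. measure \<mu> (cylinder n u)"
  have total: "(\<Sum>u\<in>cut_set n c r. ?m u) = 1"
    using M sum_measure_cylinder[OF r] by (simp add: space_\<mu>)
  have F: "F_sum n c \<mu> 1 s r - word_log_sum 1 r = (\<Sum>u\<in>cut_set n c r. ?m u * (- s * ln (ratio c u)))"
  proof -
    have "?m u * ln (ratio c u powr (- s) * ?m u) = ?m u * ln (?m u) + ?m u * (- s * ln (ratio c u))"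
      if "u \<in> cut_set n c r" for u
    proof (cases "?m u = 0")
      case False
      then have "0 < ?m u" by (simp add: zero_less_measure_iff)
      moreover have "0 < ratio c u" using that by (intro ratio_pos) (simp add: cut_set_def)
      ultimately show ?thesis by (simp add: ln_mult right_diff_distrib)
    qed simp
    then show ?thesis
      by (simp add: F_sum_def word_log_sum_def log_sum_def pterm_def sum_subtractf sum_negf)
  qed
  have ln: "ln a + ln r \<le> ln (ratio c u)" "ln (ratio c u) \<le> ln r" if "u \<in> cut_set n c r" for u
  proof -
    have u: "0 < ratio c u" using that by (intro ratio_pos) (simp add: cut_set_def)
    show "ln (ratio c u) \<le> ln r" using cut_set_ratio(1)[OF that] u r by simp
    have "ln (a * r) \<le> ln (ratio c u)" using cut_set_ratio(2)[OF that] u r a by simp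
    then show "ln a + ln r \<le> ln (ratio c u)" using a r by (simp add: ln_mult)
  qed
  have s_ln: "- s * ln r \<le> - s * ln (ratio c u)" "- s * ln (ratio c u) \<le> - s * (ln a + ln r)"
    if "u \<in> cut_set n c r" for u
    using ln[OF that] s by (auto intro: mult_left_mono_neg)
  have "(\<Sum>u\<in>cut_set n c r. ?m u * (- s * ln r)) \<le> (\<Sum>u\<in>cut_set n c r. ?m u * (- s * ln (ratio c u)))"
    by (intro sum_mono mult_left_mono[OF s_ln(1)]) auto
  then show "word_log_sum 1 r - s * ln r \<le> F_sum n c \<mu> 1 s r"
    unfolding F[symmetric] sum_distrib_right[symmetric] total by simp
  have "(\<Sum>u\<in>cut_set n c r. ?m u * (- s * ln (ratio c u))) \<le> (\<Sum>u\<in>cut_set n c r. ?m u * (- s * (ln a + ln r)))"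
    by (intro sum_mono mult_left_mono[OF s_ln(2)]) auto
  then show "F_sum n c \<mu> 1 s r \<le> word_log_sum 1 r - s * ln r - s * ln a"
    unfolding F[symmetric] sum_distrib_right[symmetric] total by (simp add: algebra_simps)
qed

text \<open>On the cut set \<open>ln (ratio c u)\<close> is within |ln a| of ln r, so each weight
  agrees with r^(s (1 - q)) up to a factor exp E; the absolute value in E covers both signs of 1 -
  q.\<close>

lemma F_sum_neq_1_bounds:
  fixes r s q :: real
  assumes r: "0 < r" "r < 1" and q: "q \<noteq> 1"
  defines "E \<equiv> \<bar>s * (1 - q) * ln a\<bar>"
  shows "0 < F_sum n c \<mu> q s r"
    and "\<bar>ln (F_sum n c \<mu> q s r) - (q - 1) * (word_log_sum q r - s * ln r)\<bar> \<le> E"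
proof -
  let ?m = "\<lambda>u. measure \<mu> (cylinder n u)"
  define e where "e = s * (1 - q)"
  define S where "S = (\<Sum>u\<in>cut_set n c r. ?m u powr q)"
  have S: "0 < S" unfolding S_def
    using total_pos sum_measure_cylinder[OF r] by (intro sum_powr_pos finite_cut_set[OF r]) auto
  have F: "F_sum n c \<mu> q s r = (\<Sum>u\<in>cut_set n c r. ratio c u powr e * ?m u powr q)"
    using q by (simp add: F_sum_def e_def)
  have c: "exp (e * ln r - E) \<le> ratio c u powr e" "ratio c u powr e \<le> exp (e * ln r + E)"
    if "u \<in> cut_set n c r" for u
  proof -
    have u: "0 < ratio c u" using that by (intro ratio_pos) (simp add: cut_set_def)
    have 1: "ln (ratio c u) \<le> ln r" using cut_set_ratio(1)[OF that] u r by simp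
    have "ln (a * r) \<le> ln (ratio c u)" using cut_set_ratio(2)[OF that] u r a by simp
    then have "\<bar>ln (ratio c u) - ln r\<bar> \<le> \<bar>ln a\<bar>" using 1 a r by (simp add: ln_mult)
    then have "\<bar>e\<bar> * \<bar>ln (ratio c u) - ln r\<bar> \<le> \<bar>e\<bar> * \<bar>ln a\<bar>" by (intro mult_left_mono) auto
    then have "\<bar>e * ln (ratio c u) - e * ln r\<bar> \<le> E"
      by (simp add: E_def e_def abs_mult flip: right_diff_distrib)
    then have "e * ln r - E \<le> e * ln (ratio c u)" "e * ln (ratio c u) \<le> e * ln r + E" by linarith+
    then show "exp (e * ln r - E) \<le> ratio c u powr e" "ratio c u powr e \<le> exp (e * ln r + E)"
      using u by (simp_all add: powr_def)
  qed
  have "(\<Sum>u\<in>cut_set n c r. exp (e * ln r - E) * ?m u powr q) \<le> F_sum n c \<mu> q s r"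
    unfolding F using c by (intro sum_mono mult_right_mono) auto
  then have lo: "exp (e * ln r - E) * S \<le> F_sum n c \<mu> q s r" by (simp add: S_def sum_distrib_left)
  have "F_sum n c \<mu> q s r \<le> (\<Sum>u\<in>cut_set n c r. exp (e * ln r + E) * ?m u powr q)"
    unfolding F using c by (intro sum_mono mult_right_mono) auto
  then have hi: "F_sum n c \<mu> q s r \<le> exp (e * ln r + E) * S" by (simp add: S_def sum_distrib_left)
  have "0 < exp (e * ln r - E) * S" using S by simp
  with lo show F0: "0 < F_sum n c \<mu> q s r" by linarith
  have "ln (exp (e * ln r - E) * S) \<le> ln (F_sum n c \<mu> q s r)"
    using lo S by (intro ln_mono) auto
  moreover have "ln (F_sum n c \<mu> q s r) \<le> ln (exp (e * ln r + E) * S)"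
    using hi F0 by (intro ln_mono) auto
  moreover have "(q - 1) * (word_log_sum q r - s * ln r) = ln S + e * ln r"
    using q by (simp add: word_log_sum_def log_sum_def pterm_def e_def flip: S_def)
      (simp add: field_simps)
  ultimately show "\<bar>ln (F_sum n c \<mu> q s r) - (q - 1) * (word_log_sum q r - s * ln r)\<bar> \<le> E"
    using S by (simp add: ln_mult)
qed

text \<open>Up to bounded errors the sum \<open>F_sum\<close>, or its logarithm, is a positive multiple of
  \<open>word_log_sum q r - s * ln r\<close> if \<open>q \<ge> 1\<close>, and a negative one if \<open>q < 1\<close>.\<close>

lemma F_sum_bounded:
  assumes q: "0 < q" "q = 1 \<longrightarrow> measure \<mu> (space \<mu>) = 1" and s: "0 < s"
  defines "\<sigma> \<equiv> if 1 \<le> q then 1 else - 1 :: real"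
  shows "\<exists>B'. \<forall>r. 0 < r \<longrightarrow> r < 1 \<longrightarrow> F_sum n c \<mu> q s r \<le> B \<longrightarrow> \<sigma> * (word_log_sum q r - s * ln r) \<le> B'"
    and "\<exists>B'. \<forall>r. 0 < r \<longrightarrow> r < 1 \<longrightarrow> \<sigma> * (word_log_sum q r - s * ln r) \<le> B \<longrightarrow> F_sum n c \<mu> q s r \<le> B'"
proof -
  have "(\<exists>B'. \<forall>r. 0 < r \<longrightarrow> r < 1 \<longrightarrow> F_sum n c \<mu> q s r \<le> B \<longrightarrow> \<sigma> * (word_log_sum q r - s * ln r) \<le> B') \<and>
    (\<exists>B'. \<forall>r. 0 < r \<longrightarrow> r < 1 \<longrightarrow> \<sigma> * (word_log_sum q r - s * ln r) \<le> B \<longrightarrow> F_sum n c \<mu> q s r \<le> B')"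
  proof (cases "q = 1")
    case True
    show ?thesis
    proof (intro conjI exI allI impI)
      fix r :: real assume r: "0 < r" "r < 1" "F_sum n c \<mu> q s r \<le> B"
      then show "\<sigma> * (word_log_sum q r - s * ln r) \<le> B"
        using F_sum_eq_1_bounds(1)[OF r(1,2) s] True q by (simp add: \<sigma>_def)
    next
      fix r :: real assume r: "0 < r" "r < 1" "\<sigma> * (word_log_sum q r - s * ln r) \<le> B"
      then show "F_sum n c \<mu> q s r \<le> B - s * ln a"
        using F_sum_eq_1_bounds(2)[OF r(1,2) s] True q by (simp add: \<sigma>_def)
    qed
  next
    case False
    define E where "E = \<bar>s * (1 - q) * ln a\<bar>"
    define p where "p = \<bar>q - 1\<bar>"
    \<comment> \<open>\<sigma> is the sign of q - 1, so only division by the positive p remains and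
      no inequality is reversed.\<close>
    have p: "0 < p" "(q - 1) * x = p * (\<sigma> * x)" for x
      using False by (auto simp: p_def \<sigma>_def)
    show ?thesis
    proof (intro conjI exI allI impI)
      fix r :: real assume r: "0 < r" "r < 1" "F_sum n c \<mu> q s r \<le> B"
      have "ln (F_sum n c \<mu> q s r) \<le> ln B"
        using F_sum_neq_1_bounds(1)[OF r(1,2) False, of s] r(3) by (intro ln_mono) auto
      then have "p * (\<sigma> * (word_log_sum q r - s * ln r)) \<le> ln B + E"
        using F_sum_neq_1_bounds(2)[OF r(1,2) False, of s] unfolding p(2) E_def by linarith
      then show "\<sigma> * (word_log_sum q r - s * ln r) \<le> (ln B + E) / p"
        using p(1) by (simp add: le_divide_eq mult.commute)
    next
      fix r :: real assume r: "0 < r" "r < 1" "\<sigma> * (word_log_sum q r - s * ln r) \<le> B"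
      then have "p * (\<sigma> * (word_log_sum q r - s * ln r)) \<le> p * B"
        using p(1) by (intro mult_left_mono) auto
      then have "ln (F_sum n c \<mu> q s r) \<le> p * B + E"
        using F_sum_neq_1_bounds(2)[OF r(1,2) False, of s] unfolding p(2) E_def by linarith
      then show "F_sum n c \<mu> q s r \<le> exp (p * B + E)"
        using F_sum_neq_1_bounds(1)[OF r(1,2) False, of s] by (metis exp_le_cancel_iff exp_ln)
    qed
  qed
  then show "\<exists>B'. \<forall>r. 0 < r \<longrightarrow> r < 1 \<longrightarrow> F_sum n c \<mu> q s r \<le> B \<longrightarrow> \<sigma> * (word_log_sum q r - s * ln r) \<le> B'"
    and "\<exists>B'. \<forall>r. 0 < r \<longrightarrow> r < 1 \<longrightarrow> \<sigma> * (word_log_sum q r - s * ln r) \<le> B \<longrightarrow> F_sum n c \<mu> q s r \<le> B'"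
    by blast+
qed

text \<open>Replacing cylinder masses by cube masses costs a constant, which boundedness does not
  notice. The form \<sigma> * h - \<sigma> * s * ln r lets the quotient lemmas be applied to -h and
  -s when q < 1.\<close>

lemma F_sum_finite_iff:
  assumes q: "0 < q" "q = 1 \<longrightarrow> measure \<mu> (space \<mu>) = 1" and s: "0 < s"
  defines "\<sigma> \<equiv> if 1 \<le> q then 1 else - 1 :: real"
  shows "Limsup (at_right 0) (\<lambda>r. ereal (F_sum n c \<mu> q s r)) < \<infinity> \<longleftrightarrow>
      (\<exists>B. \<forall>\<^sub>F r in at_right 0. \<sigma> * cube_log_sum q r - \<sigma> * s * ln r \<le> B)"
    and "Liminf (at_right 0) (\<lambda>r. ereal (F_sum n c \<mu> q s r)) < \<infinity> \<longleftrightarrow>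
      (\<exists>B. \<exists>\<^sub>F r in at_right 0. \<sigma> * cube_log_sum q r - \<sigma> * s * ln r \<le> B)"
proof -
  obtain C where C: "\<And>r. 0 < r \<Longrightarrow> r < 1 \<Longrightarrow> \<bar>word_log_sum q r - cube_log_sum q r\<bar> \<le> C"
    using cube_word_log_sum[OF q] by blast
  have near: "\<bar>\<sigma> * (word_log_sum q r - s * ln r) - (\<sigma> * cube_log_sum q r - \<sigma> * s * ln r)\<bar> \<le> C"
    if "0 < r" "r < 1" for r
    using C[OF that] by (auto simp: \<sigma>_def)
  have 1: "\<exists>B'. \<forall>r. 0 < r \<longrightarrow> r < 1 \<longrightarrow> F_sum n c \<mu> q s r \<le> B \<longrightarrow> \<sigma> * cube_log_sum q r - \<sigma> * s * ln r \<le> B'"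
    for B
  proof -
    obtain B' where B': "\<forall>r. 0 < r \<longrightarrow> r < 1 \<longrightarrow> F_sum n c \<mu> q s r \<le> B \<longrightarrow> \<sigma> * (word_log_sum q r - s * ln r) \<le> B'"
      using F_sum_bounded(1)[OF q s] unfolding \<sigma>_def by blast
    show ?thesis
    proof (intro exI[of _ "B' + C"] allI impI)
      fix r :: real assume r: "0 < r" "r < 1" "F_sum n c \<mu> q s r \<le> B"
      then have "\<sigma> * (word_log_sum q r - s * ln r) \<le> B'" using B' by blast
      then show "\<sigma> * cube_log_sum q r - \<sigma> * s * ln r \<le> B' + C" using near[OF r(1,2)] by linarith
    qed
  qed
  have 2: "\<exists>B'. \<forall>r. 0 < r \<longrightarrow> r < 1 \<longrightarrow> \<sigma> * cube_log_sum q r - \<sigma> * s * ln r \<le> B \<longrightarrow> F_sum n c \<mu> q s r \<le> B'"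
    for B
  proof -
    obtain B' where B': "\<forall>r. 0 < r \<longrightarrow> r < 1 \<longrightarrow> \<sigma> * (word_log_sum q r - s * ln r) \<le> B + C \<longrightarrow> F_sum n c \<mu> q s r \<le> B'"
      using F_sum_bounded(2)[OF q s] unfolding \<sigma>_def by blast
    show ?thesis
    proof (intro exI[of _ B'] allI impI)
      fix r :: real assume r: "0 < r" "r < 1" "\<sigma> * cube_log_sum q r - \<sigma> * s * ln r \<le> B"
      then have "\<sigma> * (word_log_sum q r - s * ln r) \<le> B + C" using near[OF r(1,2)] by linarith
      then show "F_sum n c \<mu> q s r \<le> B'" using B' r by blast
    qed
  qed
  note iff = eventually_bounded_iff[OF 1 2]
  show "Limsup (at_right 0) (\<lambda>r. ereal (F_sum n c \<mu> q s r)) < \<infinity> \<longleftrightarrow>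
      (\<exists>B. \<forall>\<^sub>F r in at_right 0. \<sigma> * cube_log_sum q r - \<sigma> * s * ln r \<le> B)"
    unfolding Limsup_ereal_finite_iff by (rule iff(1))
  show "Liminf (at_right 0) (\<lambda>r. ereal (F_sum n c \<mu> q s r)) < \<infinity> \<longleftrightarrow>
      (\<exists>B. \<exists>\<^sub>F r in at_right 0. \<sigma> * cube_log_sum q r - \<sigma> * s * ln r \<le> B)"
    unfolding Liminf_ereal_finite_iff by (rule iff(2))
qed

section \<open>Dimensions as limits of a real quotient\<close>

lemma dims_eq_Liminf_Limsup:
  assumes q: "0 < q"
  shows "lower_dim q (image_measure JJ \<mu>) = Liminf (at_right 0) (\<lambda>r. ereal (cube_log_sum q r / ln r))"
    and "upper_dim q (image_measure JJ \<mu>) = Limsup (at_right 0) (\<lambda>r. ereal (cube_log_sum q r / ln r))"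
proof -
  have "\<forall>\<^sub>F r in at_right 0. dim_quotient q (image_measure JJ \<mu>) r = ereal (cube_log_sum q r / ln r)"
    using eventually_unit_interval by eventually_elim (use dim_quotient_eq q in auto)
  then show "lower_dim q (image_measure JJ \<mu>) = Liminf (at_right 0) (\<lambda>r. ereal (cube_log_sum q r / ln r))"
    and "upper_dim q (image_measure JJ \<mu>) = Limsup (at_right 0) (\<lambda>r. ereal (cube_log_sum q r / ln r))"
    unfolding lower_dim_def upper_dim_def by (auto intro: Liminf_eq Limsup_eq)
qed

text \<open>Passing to -h exchanges liminf and limsup; this serves q < 1 and the upper bound by the
  dimension of the space.\<close>

lemma uminus_ln_quotient:
  fixes h :: "real \<Rightarrow> real"
  shows "Liminf (at_right 0) (\<lambda>r. ereal (- h r / ln r)) = - Limsup (at_right 0) (\<lambda>r. ereal (h r / ln r))"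
    and "Limsup (at_right 0) (\<lambda>r. ereal (- h r / ln r)) = - Liminf (at_right 0) (\<lambda>r. ereal (h r / ln r))"
  using ereal_Liminf_uminus[of "at_right 0" "\<lambda>r. ereal (h r / ln r)"]
    ereal_Limsup_uminus[of "at_right 0" "\<lambda>r. ereal (h r / ln r)"]
  by simp_all

lemma dims_bounds:
  assumes q: "0 < q" "q = 1 \<longrightarrow> measure \<mu> (space \<mu>) = 1"
  shows "0 \<le> lower_dim q (image_measure JJ \<mu>)"
    and "lower_dim q (image_measure JJ \<mu>) \<le> upper_dim q (image_measure JJ \<mu>)"
    and "upper_dim q (image_measure JJ \<mu>) \<le> ereal (real CARD('d))"
proof -
  obtain C where C: "\<And>r. 0 < r \<Longrightarrow> r < 1 \<Longrightarrow> \<bar>word_log_sum q r - cube_log_sum q r\<bar> \<le> C"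
    using cube_word_log_sum[OF q] by blast
  obtain B where B: "\<And>r. 0 < r \<Longrightarrow> r < 1 \<Longrightarrow> word_log_sum q r \<le> B"
    "\<And>r. 0 < r \<Longrightarrow> r < 1 \<Longrightarrow> real CARD('d) * ln r - B \<le> word_log_sum q r"
    using word_log_sum_bounds[OF q] by blast
  have "cube_log_sum q r - 0 * ln r \<le> B + C" if "0 < r" "r < 1" for r
    using B(1)[OF that] C[OF that] by simp
  then have "\<forall>\<^sub>F r in at_right 0. cube_log_sum q r - 0 * ln r \<le> B + C"
    using eventually_unit_interval by (auto elim: eventually_mono)
  from le_Liminf_ln_quotient[OF this] show "0 \<le> lower_dim q (image_measure JJ \<mu>)"
    by (simp add: dims_eq_Liminf_Limsup[OF q(1)] zero_ereal_def)
  show "lower_dim q (image_measure JJ \<mu>) \<le> upper_dim q (image_measure JJ \<mu>)"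
    unfolding lower_dim_def upper_dim_def by (rule Liminf_le_Limsup) simp
  \<comment> \<open>The lower bound d * ln r - B for N, read as an upper bound for -h with exponent
    -d.\<close>
  have "- cube_log_sum q r - (- real CARD('d)) * ln r \<le> B + C" if "0 < r" "r < 1" for r
    using B(2)[OF that] C[OF that] by simp
  then have "\<forall>\<^sub>F r in at_right 0. - cube_log_sum q r - (- real CARD('d)) * ln r \<le> B + C"
    using eventually_unit_interval by (auto elim: eventually_mono)
  from le_Liminf_ln_quotient[OF this] show "upper_dim q (image_measure JJ \<mu>) \<le> ereal (real CARD('d))"
    unfolding uminus_ln_quotient
    by (simp add: dims_eq_Liminf_Limsup[OF q(1)] flip: uminus_ereal.simps)
qed

text \<open>For q \<ge> 1 a bound on \<open>F_sum\<close> bounds h - s * ln r from above, so s lies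
  below a limit of h / ln r; for q < 1 it bounds it from below, so s lies above one. Hence sup
  becomes inf and liminf and limsup trade places in the critical values.\<close>

lemma dims_eq_critical_values:
  assumes q: "0 < q" "q = 1 \<longrightarrow> measure \<mu> (space \<mu>) = 1"
  shows "lower_dim q (image_measure JJ \<mu>) = d_minus n c \<mu> q"
    and "upper_dim q (image_measure JJ \<mu>) = d_plus n c \<mu> q"
proof -
  let ?h = "cube_log_sum q"
  let ?lo = "Liminf (at_right 0) (\<lambda>r. ereal (?h r / ln r))"
  let ?hi = "Limsup (at_right 0) (\<lambda>r. ereal (?h r / ln r))"
  note dims = dims_eq_Liminf_Limsup[OF q(1)]
  have lo: "0 \<le> ?lo" and hi: "0 \<le> ?hi"
    using dims_bounds[OF q] unfolding dims by auto
  have "d_minus n c \<mu> q = ?lo \<and> d_plus n c \<mu> q = ?hi"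
  proof (cases "1 \<le> q")
    case True
    note iff = F_sum_finite_iff[OF q, unfolded if_P[OF True] mult_1]
    have "Sup (insert 0 (ereal ` limsup_finite_exponents n c \<mu> q)) = ?lo"
      unfolding limsup_finite_exponents_def
    proof (rule Sup_positive_exponents[OF lo])
      fix s :: real assume s: "0 < s" "Limsup (at_right 0) (\<lambda>r. ereal (F_sum n c \<mu> q s r)) < \<infinity>"
      then show "ereal s \<le> ?lo" unfolding iff(1)[OF s(1)] using le_Liminf_ln_quotient by blast
    next
      fix s :: real assume s: "0 < s" "ereal s < ?lo"
      from less_Liminf_ln_quotient[OF s(2)]
      show "Limsup (at_right 0) (\<lambda>r. ereal (F_sum n c \<mu> q s r)) < \<infinity>" unfolding iff(1)[OF s(1)] by blast
    qed
    moreover have "Sup (insert 0 (ereal ` liminf_finite_exponents n c \<mu> q)) = ?hi"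
      unfolding liminf_finite_exponents_def
    proof (rule Sup_positive_exponents[OF hi])
      fix s :: real assume s: "0 < s" "Liminf (at_right 0) (\<lambda>r. ereal (F_sum n c \<mu> q s r)) < \<infinity>"
      then show "ereal s \<le> ?hi" unfolding iff(2)[OF s(1)] using le_Limsup_ln_quotient by blast
    next
      fix s :: real assume s: "0 < s" "ereal s < ?hi"
      from less_Limsup_ln_quotient[OF s(2)]
      show "Liminf (at_right 0) (\<lambda>r. ereal (F_sum n c \<mu> q s r)) < \<infinity>" unfolding iff(2)[OF s(1)] by blast
    qed
    ultimately show ?thesis using True by (simp add: d_minus_def d_plus_def)
  next
    case False
    note iff = F_sum_finite_iff[OF q, unfolded if_not_P[OF False] mult_minus1]
    have "Inf (ereal ` liminf_finite_exponents n c \<mu> q) = ?lo"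
      unfolding liminf_finite_exponents_def
    proof (rule Inf_positive_exponents[OF lo])
      fix s :: real assume s: "0 < s" "Liminf (at_right 0) (\<lambda>r. ereal (F_sum n c \<mu> q s r)) < \<infinity>"
      then obtain B where "\<exists>\<^sub>F r in at_right 0. - ?h r - (- s) * ln r \<le> B"
        unfolding iff(2)[OF s(1)] by blast
      from le_Limsup_ln_quotient[OF this] show "?lo \<le> ereal s"
        unfolding uminus_ln_quotient by (simp flip: uminus_ereal.simps)
    next
      fix s :: real assume s: "0 < s" "?lo < ereal s"
      then have "ereal (- s) < Limsup (at_right 0) (\<lambda>r. ereal (- ?h r / ln r))"
        unfolding uminus_ln_quotient by (simp flip: uminus_ereal.simps)
      from less_Limsup_ln_quotient[OF this]
      show "Liminf (at_right 0) (\<lambda>r. ereal (F_sum n c \<mu> q s r)) < \<infinity>" unfolding iff(2)[OF s(1)] by blast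
    qed
    moreover have "Inf (ereal ` limsup_finite_exponents n c \<mu> q) = ?hi"
      unfolding limsup_finite_exponents_def
    proof (rule Inf_positive_exponents[OF hi])
      fix s :: real assume s: "0 < s" "Limsup (at_right 0) (\<lambda>r. ereal (F_sum n c \<mu> q s r)) < \<infinity>"
      then obtain B where "\<forall>\<^sub>F r in at_right 0. - ?h r - (- s) * ln r \<le> B"
        unfolding iff(1)[OF s(1)] by blast
      from le_Liminf_ln_quotient[OF this] show "?hi \<le> ereal s"
        unfolding uminus_ln_quotient by (simp flip: uminus_ereal.simps)
    next
      fix s :: real assume s: "0 < s" "?hi < ereal s"
      then have "ereal (- s) < Liminf (at_right 0) (\<lambda>r. ereal (- ?h r / ln r))"
        unfolding uminus_ln_quotient by (simp flip: uminus_ereal.simps)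
      from less_Liminf_ln_quotient[OF this]
      show "Limsup (at_right 0) (\<lambda>r. ereal (F_sum n c \<mu> q s r)) < \<infinity>" unfolding iff(1)[OF s(1)] by blast
    qed
    ultimately show ?thesis using False by (simp add: d_minus_def d_plus_def)
  qed
  then show "lower_dim q (image_measure JJ \<mu>) = d_minus n c \<mu> q"
    and "upper_dim q (image_measure JJ \<mu>) = d_plus n c \<mu> q"
    unfolding dims by simp_all
qed

end

theorem theorem2p4:
  fixes n :: "nat \<Rightarrow> nat"
    and T :: "nat \<Rightarrow> nat \<Rightarrow> real^'d^'d"
    and c :: "nat \<Rightarrow> nat \<Rightarrow> real"
    and \<omega> :: "nat list \<Rightarrow> real^'d"
    and J :: "(real^'d) set"
    and JJ :: "nat list \<Rightarrow> (real^'d) set"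
    and E :: "(real^'d) set"
    and \<mu> :: "(nat \<Rightarrow> nat) measure"
    and q :: real
  assumes "nonautonomous_similar_set n T c \<omega> J JJ E"
    and "(INF (k, i)\<in>(SIGMA k:UNIV. {1..n k}). c k i) > 0"
    and "(SUP (k, i)\<in>(SIGMA k:UNIV. {1..n k}). c k i) < 1"
    and "strong_separation n JJ"
    and "positive_finite_borel_measure_on_words n \<mu>"
    and "q > 0"
    and "q = 1 \<longrightarrow> measure \<mu> (space \<mu>) = 1"
  shows "lower_dim q (image_measure JJ \<mu>) = min (d_minus n c \<mu> q) (ereal (real CARD('d)))
       \<and> upper_dim q (image_measure JJ \<mu>) = min (d_plus n c \<mu> q) (ereal (real CARD('d)))"
proof -
  let ?S = "SIGMA k:UNIV. {1..n k}" and ?f = "\<lambda>(k, i). c k i"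
  have set: "2 \<le> n k" "compact J" "interior J \<noteq> {}" "contracting_similarities n T c"
    "nonautonomous_structure n T \<omega> J JJ" for k
    using assms(1) by (auto simp: nonautonomous_similar_set_def)
  have c01: "0 < c k i" "c k i < 1" if "i \<in> {1..n k}" for k i
    using set(4) that by (auto simp: contracting_similarities_def)
  \<comment> \<open>Boundedness makes the real infimum and supremum genuine bounds for every
    ratio.\<close>
  have "bdd_below (?f ` ?S)" "bdd_above (?f ` ?S)"
    using c01 by (fastforce intro!: bdd_belowI[of _ 0] bdd_aboveI[of _ 1] less_imp_le)+
  then have c: "(INF p\<in>?S. ?f p) \<le> c k i \<and> c k i \<le> (SUP p\<in>?S. ?f p)" if "i \<in> {1..n k}" for k i
    using that cINF_lower[of ?f ?S "(k, i)"] cSUP_upper[of "(k, i)" ?S ?f] by auto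
  have one: "1 \<in> {1..n 0}" using set(1)[of 0] by simp
  have "0 < (SUP p\<in>?S. ?f p)" using c[OF one] c01[OF one] by linarith
  then interpret separated_similar_measure n c "INF p\<in>?S. ?f p" "SUP p\<in>?S. ?f p" T \<omega> J JJ \<mu>
    using assms set c by unfold_locales auto
  \<comment> \<open>The dimensions equal the critical values and are at most
    \<open>CARD('d)\<close>, so the minimum returns the critical value.\<close>
  have "lower_dim q (image_measure JJ \<mu>) \<le> ereal (real CARD('d))"
    "upper_dim q (image_measure JJ \<mu>) \<le> ereal (real CARD('d))"
    using dims_bounds[OF assms(6,7)] by auto
  then show ?thesis
    using dims_eq_critical_values[OF assms(6,7)] by (simp add: min_def)
qed

end
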